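(* Let $p$ be a prime with $p\equiv 1\pmod 8$ and let $E$ be the elliptic curve $y^2=x^3-p^2x$ over $\mathbb{Q}$. Then the rank $r(E)$ of $E(\mathbb{Q})$ equals $2$ whenever $p$ satisfies the following two conditions: (1) there exist $a,b\in\mathbb{N}$ such that $p=a+b$, $a-b$ is a perfect square and $a^2+b^2$ is a perfect square; (2) there exist $a,b\in\mathbb{N}$ such that $p=a^2+b^2$, $\gcd(a,2b)=1$, and at least one of $(a+2b)^2+b^2$ and $(a-2b)^2+b^2$ is a perfect square.
   Context: $\mathbb{N}$ denotes the positive integers. *)

theory Defs
  imports
    "HOL-Algebra.FiniteProduct"
    "HOL-Computational_Algebra.Primes"
    "HOL-Computational_Algebra.Nth_Powers"
    "HOL-Library.Extended_Nat"
begin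

datatype 'a ec_point = Infinity | Affine 'a 'a

text \<open>
  Short Weierstrass curves \<open>y^2 = x^3 + A x + B\<close>. The addition law below is the chord-tangent law
  in characteristic other than 2, and is only meaningful when the curve is nonsingular.
\<close>

fun on_ec :: "'a::field \<Rightarrow> 'a \<Rightarrow> 'a ec_point \<Rightarrow> bool" where
  "on_ec A B Infinity \<longleftrightarrow> True"
| "on_ec A B (Affine x y) \<longleftrightarrow> y ^ 2 = x ^ 3 + A * x + B"

fun ec_add :: "'a::field \<Rightarrow> 'a ec_point \<Rightarrow> 'a ec_point \<Rightarrow> 'a ec_point" where
  "ec_add A Infinity Q = Q"
| "ec_add A P Infinity = P"
| "ec_add A (Affine x1 y1) (Affine x2 y2) =
     (if x1 = x2 \<and> y1 = - y2 then Infinity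
      else
        let l = (if x1 = x2 then (3 * x1 ^ 2 + A) / (2 * y1) else (y2 - y1) / (x2 - x1));
            x3 = l ^ 2 - x1 - x2
        in Affine x3 (l * (x1 - x3) - y1))"

text \<open>The group of points rational over the field \<open>'a\<close>, written multiplicatively.\<close>

definition ec_group :: "'a::field \<Rightarrow> 'a \<Rightarrow> 'a ec_point monoid" where
  "ec_group A B = \<lparr>carrier = {P. on_ec A B P}, monoid.mult = ec_add A, one = Infinity\<rparr>"

text \<open>Linear independence over the integers, in multiplicative notation.\<close>

definition int_independent :: "('a, 'b) monoid_scheme \<Rightarrow> 'a set \<Rightarrow> bool" where
  "int_independent G S \<longleftrightarrow>
     finite S \<and> S \<subseteq> carrier G \<and>
     (\<forall>c :: 'a \<Rightarrow> int. finprod G (\<lambda>x. x [^]\<^bsub>G\<^esub> c x) S = \<one>\<^bsub>G\<^esub> \<longrightarrow> (\<forall>x\<in>S. c x = 0))"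

text \<open>
  The rank of an abelian group; for a finitely generated group \<open>\<int>^r \<times> T\<close> with \<open>T\<close> finite it is \<open>r\<close>.
  It takes values in the extended naturals so that an unbounded supremum is \<open>\<infinity>\<close>, not a junk value.
\<close>

definition abelian_group_rank :: "('a, 'b) monoid_scheme \<Rightarrow> enat" where
  "abelian_group_rank G = (SUP S \<in> {S. int_independent G S}. enat (card S))"

end

theory Submission
  imports Defs
begin

text \<open>
  Let \<open>E\<close> be \<open>y^2 = x (x - p) (x + p)\<close>. The maps \<open>P \<mapsto> x\<close> and \<open>P \<mapsto> x - p\<close> into square classes are
  homomorphisms, and valuations show that only the sign and the parities at \<open>2\<close> and \<open>p\<close> matter; the
  valuation of \<open>x\<close> at \<open>2\<close> is automatically even. After removing the contribution of \<open>E[2]\<close> two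
  parity characters remain, and a point on which both vanish is a double modulo \<open>E[2]\<close>. So among
  the nontrivial \<open>0/1\<close> combinations of three points one is of the form \<open>2 R + T\<close> with \<open>T\<close> in \<open>E[2]\<close>.

  If the three points are independent, replacing one of them by \<open>R\<close> strictly enlarges the subgroup
  they generate modulo \<open>E[2]\<close>. Choosing signs by the parallelogram law, the logarithmic height of \<open>R\<close> is
  at most about \<open>3/4\<close> of the maximum, so the new triple obeys the same height bound; as there are only
  finitely many triples below a bound, this cannot go on forever, and the rank is at most \<open>2\<close>. This
  replaces the Mordell-Weil theorem.

  For the lower bound, each of the two conditions yields a point on which exactly one of the two
  characters is nontrivial, and such points are independent because \<open>E\<close> has no point of order \<open>4\<close>.
\<close>

section \<open>The group law\<close>

fun ec_neg :: "'a::field ec_point \<Rightarrow> 'a ec_point" where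
  "ec_neg Infinity = Infinity"
| "ec_neg (Affine x y) = Affine x (- y)"

text \<open>One relation serves chords and tangents: the first equation determines \<open>l\<close>
  when \<open>x1 \<noteq> x2\<close>; the second, obtained by cancelling \<open>x1 - x2\<close> from
  the difference of the two curve equations, does so when \<open>y1 + y2 \<noteq> 0\<close>. Without
  division, most geometric facts become ideal membership problems for
  \<open>algebra\<close>.\<close>

definition ec_slope :: "'a::field \<Rightarrow> 'a \<Rightarrow> 'a \<Rightarrow> 'a \<Rightarrow> 'a \<Rightarrow> 'a \<Rightarrow> bool" where
  "ec_slope A x1 y1 x2 y2 l \<longleftrightarrow>
     l * (x1 - x2) = y1 - y2 \<and> l * (y1 + y2) = x1 ^ 2 + x1 * x2 + x2 ^ 2 + A"

locale elliptic_curve =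
  fixes A B :: "'a::field"
  assumes two_nonzero: "(2::'a) \<noteq> 0"
    and nonsingular: "x ^ 3 + A * x + B = 0 \<Longrightarrow> 3 * x ^ 2 + A \<noteq> 0"
begin

abbreviation add (infixl "\<^bold>+" 65) where "P \<^bold>+ Q \<equiv> ec_add A P Q"

lemma add_eq_of_slope:
  assumes "\<not> (x1 = x2 \<and> y1 = - y2)" "ec_slope A x1 y1 x2 y2 l"
    "x3 = l ^ 2 - x1 - x2" "y3 = l * (x1 - x3) - y1"
  shows "Affine x1 y1 \<^bold>+ Affine x2 y2 = Affine x3 y3"
proof (cases "x1 = x2")
  case True
  with assms have "y1 = y2" "y1 + y2 \<noteq> 0" "l * (y1 + y2) = 3 * x1 ^ 2 + A"
    by (auto simp: ec_slope_def power2_eq_square algebra_simps eq_neg_iff_add_eq_0)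
  hence "l = (3 * x1 ^ 2 + A) / (2 * y1)"
    by (simp add: field_simps)
  with True assms show ?thesis by (simp add: Let_def)
next
  case False
  hence "l = (y2 - y1) / (x2 - x1)"
    using assms(2) by (auto simp: ec_slope_def divide_simps) (simp add: algebra_simps)
  with False assms(3,4) show ?thesis by (simp add: Let_def)
qed

lemma add_opp [simp]:
  "Affine x y \<^bold>+ Affine x (- y) = Infinity" "Affine x (- y) \<^bold>+ Affine x y = Infinity"
  by simp_all

declare ec_add.simps(3) [simp del]

lemma slope_exists:
  assumes "on_ec A B (Affine x1 y1)" "on_ec A B (Affine x2 y2)" "\<not> (x1 = x2 \<and> y1 = - y2)"
  shows "\<exists>l. ec_slope A x1 y1 x2 y2 l"
proof (cases "x1 = x2")
  case True
  with assms have "y1 ^ 2 = y2 ^ 2" by simp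
  with True assms(3) have "y1 = y2" by (auto simp: power2_eq_iff)
  with True assms(3) have "2 * y1 \<noteq> 0"
    using two_nonzero by (auto simp: eq_neg_iff_add_eq_0)
  hence "ec_slope A x1 y1 x2 y2 ((3 * x1 ^ 2 + A) / (2 * y1))"
    using True \<open>y1 = y2\<close> by (simp add: ec_slope_def field_simps power2_eq_square)
  thus ?thesis ..
next
  case False
  have "(y1 - y2) * (y1 + y2) = (x1 - x2) * (x1 ^ 2 + x1 * x2 + x2 ^ 2 + A)"
    using assms(1,2) by simp algebra
  hence "ec_slope A x1 y1 x2 y2 ((y1 - y2) / (x1 - x2))"
    using False by (simp add: ec_slope_def field_simps)
  thus ?thesis ..
qed

lemma slope_commute: "ec_slope A x1 y1 x2 y2 l \<Longrightarrow> ec_slope A x2 y2 x1 y1 l"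
  unfolding ec_slope_def by algebra

lemma same_x:
  assumes "on_ec A B (Affine x y1)" "on_ec A B (Affine x y2)"
  shows "y1 = y2 \<or> y1 = - y2"
  using assms by (simp add: power2_eq_iff[symmetric])

lemma add_neg: "P \<^bold>+ ec_neg P = Infinity" "ec_neg P \<^bold>+ P = Infinity"
  by (cases P; simp)+

lemma add_zero [simp]: "P \<^bold>+ Infinity = P"
  by (cases P) simp_all

lemma neg_neg [simp]: "ec_neg (ec_neg P) = P"
  by (cases P) simp_all

lemma on_neg [simp]: "on_ec A B (ec_neg P) = on_ec A B P"
  by (cases P) simp_all

lemma affine_add_cases:
  assumes "on_ec A B (Affine x1 y1)" "on_ec A B (Affine x2 y2)"
  obtains "Affine x2 y2 = ec_neg (Affine x1 y1)"
  | l x3 y3 where "\<not> (x1 = x2 \<and> y1 = - y2)" "ec_slope A x1 y1 x2 y2 l" "x3 = l ^ 2 - x1 - x2"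
      "y3 = l * (x1 - x3) - y1" "Affine x1 y1 \<^bold>+ Affine x2 y2 = Affine x3 y3"
proof (cases "x1 = x2 \<and> y1 = - y2")
  case False
  then obtain l where "ec_slope A x1 y1 x2 y2 l"
    using slope_exists[OF assms] by blast
  with False show ?thesis using add_eq_of_slope[OF False _ refl refl] that(2) by blast
qed (use that(1) in auto)

lemma add_commute:
  assumes "on_ec A B P" "on_ec A B Q"
  shows "P \<^bold>+ Q = Q \<^bold>+ P"
proof (cases P; cases Q)
  fix x1 y1 x2 y2 assume PQ: "P = Affine x1 y1" "Q = Affine x2 y2"
  show ?thesis
  proof (cases "x1 = x2 \<and> y1 = - y2")
    case False
    then obtain l where l: "ec_slope A x1 y1 x2 y2 l"
      using slope_exists assms PQ by blast
    define x3 where "x3 = l ^ 2 - x1 - x2"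
    have "Affine x1 y1 \<^bold>+ Affine x2 y2 = Affine x3 (l * (x1 - x3) - y1)"
      using add_eq_of_slope[OF False l x3_def] by simp
    moreover have "Affine x2 y2 \<^bold>+ Affine x1 y1 = Affine x3 (l * (x1 - x3) - y1)"
    proof (rule add_eq_of_slope)
      show "ec_slope A x2 y2 x1 y1 l" by (rule slope_commute[OF l])
      show "l * (x1 - x3) - y1 = l * (x2 - x3) - y2"
        using l by (simp add: ec_slope_def algebra_simps)
    qed (use False in \<open>auto simp: x3_def\<close>)
    ultimately show ?thesis unfolding PQ by simp
  qed (auto simp: PQ)
qed simp_all

text \<open>The line through \<open>P\<close> and \<open>Q\<close> meets the curve a third time at
  \<open>- (P + Q)\<close>, so its mirror image passes through \<open>P + Q\<close> and
  \<open>- Q\<close>. Closure and cancellation both rest on this.\<close>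

lemma slope_neg_sum:
  assumes "ec_slope A x1 y1 x2 y2 l" "x3 = l ^ 2 - x1 - x2" "y3 = l * (x1 - x3) - y1"
  shows "ec_slope A x3 y3 x2 (- y2) (- l)"
  using assms unfolding ec_slope_def by algebra

lemma on_add:
  assumes "on_ec A B P" "on_ec A B Q"
  shows "on_ec A B (P \<^bold>+ Q)"
proof (cases P; cases Q)
  fix x1 y1 x2 y2 assume PQ: "P = Affine x1 y1" "Q = Affine x2 y2"
  from assms[unfolded PQ] show ?thesis
  proof (cases rule: affine_add_cases)
    case (2 l x3 y3)
    \<comment> \<open>Multiplying the two slope equations between \<open>P + Q\<close> and
      \<open>- Q\<close> gives the difference of their curve equations, so \<open>P + Q\<close> lies
      on the curve because \<open>Q\<close> does.\<close>
    from slope_neg_sum[OF 2(2-4)] assms(2)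
    have "y3 ^ 2 = x3 ^ 3 + A * x3 + B"
      unfolding ec_slope_def PQ on_ec.simps by algebra
    with 2 show ?thesis by (simp add: PQ)
  qed (simp add: PQ)
qed (use assms in simp_all)

text \<open>Running the mirrored line backwards recovers \<open>P\<close>. This law precedes
  associativity and settles its exceptional cases.\<close>

lemma add_cancel:
  assumes "on_ec A B P" "on_ec A B Q"
  shows "(P \<^bold>+ Q) \<^bold>+ ec_neg Q = P"
proof (cases P; cases Q)
  fix x1 y1 x2 y2 assume PQ: "P = Affine x1 y1" "Q = Affine x2 y2"
  from assms[unfolded PQ] show ?thesis
  proof (cases rule: affine_add_cases)
    case (2 l x3 y3)
    note s = slope_neg_sum[OF 2(2-4)]
    have "\<not> (x3 = x2 \<and> y3 = - (- y2))"
    proof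
      \<comment> \<open>If \<open>P + Q = Q\<close>, the slope equations say that \<open>y2\<close>
        and the derivative of the cubic at \<open>x2\<close> both vanish, so \<open>Q\<close> would
        be singular.\<close>
      assume *: "x3 = x2 \<and> y3 = - (- y2)"
      with s have "2 * y2 = 0" by (auto simp: ec_slope_def)
      hence "y2 = 0" using two_nonzero by simp
      moreover from s * have "3 * x2 ^ 2 + A = 0"
        by (simp add: ec_slope_def power2_eq_square algebra_simps)
      ultimately show False using nonsingular[of x2] assms(2) by (simp add: PQ)
    qed
    hence "Affine x3 y3 \<^bold>+ Affine x2 (- y2) = Affine x1 y1"
      by (rule add_eq_of_slope[OF _ s]) (use 2(3,4) in \<open>simp_all add: algebra_simps\<close>)
    with 2(5) show ?thesis unfolding PQ by simp
  qed (simp add: PQ)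
qed (simp_all add: add_neg)

lemma neg_add:
  assumes "on_ec A B P" "on_ec A B Q"
  shows "ec_neg (P \<^bold>+ Q) = ec_neg P \<^bold>+ ec_neg Q"
proof (cases P; cases Q)
  fix x1 y1 x2 y2 assume PQ: "P = Affine x1 y1" "Q = Affine x2 y2"
  from assms[unfolded PQ] show ?thesis
  proof (cases rule: affine_add_cases)
    case (2 l x3 y3)
    have "\<not> (x1 = x2 \<and> - y1 = - (- y2))" "ec_slope A x1 (- y1) x2 (- y2) (- l)"
      using 2(1,2) by (auto simp: ec_slope_def algebra_simps)
    hence "Affine x1 (- y1) \<^bold>+ Affine x2 (- y2) = Affine x3 (- y3)"
      by (rule add_eq_of_slope) (use 2(3,4) in \<open>simp_all add: algebra_simps\<close>)
    with 2(5) show ?thesis unfolding PQ by simp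
  qed (simp add: PQ)
qed simp_all

text \<open>
  The function \<open>(x - x1) (x - x2) + d (l (x - x1) + y1 - y)\<close>, where \<open>y = l (x - x1) + y1\<close> is the line
  through \<open>P\<close> and \<open>Q\<close> and \<open>d\<close> is the sum of the slopes of the lines used for \<open>(P + Q) + R\<close>, vanishes
  at \<open>P\<close>, \<open>Q\<close>, \<open>R\<close> and \<open>- ((P + Q) + R)\<close>. The vanishing at \<open>R\<close> uses no case
  distinction between chords and tangents.
\<close>

lemma slope_sum:
  assumes "ec_slope A x1 y1 x2 y2 l" "xs = l ^ 2 - x1 - x2" "ys = l * (x1 - xs) - y1"
    "ec_slope A xs ys x3 y3 k"
  shows "(l + k) * (y3 - y1 - l * (x3 - x1)) = (x3 - x1) * (x3 - x2)"
  using assms unfolding ec_slope_def by algebra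

text \<open>With a common value \<open>d\<close> of the two slope sums, \<open>k = d - l\<close> and
  \<open>n = d - m\<close>. The x-coordinates of both bracketings then agree by polynomial algebra
  from \<open>d * (m - l) = x3 - x1\<close>, and the y-coordinates follow.\<close>

lemma assoc_of_slope_sums:
  assumes "ec_slope A x1 y1 x2 y2 l" "xs = l ^ 2 - x1 - x2" "ys = l * (x1 - xs) - y1"
    "xu = k ^ 2 - xs - x3" "yu = k * (xs - xu) - ys"
    "ec_slope A x2 y2 x3 y3 m" "xt = m ^ 2 - x2 - x3" "yt = m * (x2 - xt) - y2"
    "n * (x1 - xt) = y1 - yt" "xv = n ^ 2 - x1 - xt" "yv = n * (x1 - xv) - y1"
    "l + k = m + n" "(l + k) * (m - l) = x3 - x1"
  shows "xu = xv" "yu = yv"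
proof -
  define d where "d = l + k"
  have k: "k = d - l" and n: "n = d - m" using assms(12) by (auto simp: d_def algebra_simps)
  have d: "d * m = x3 - x1 + d * l" using assms(13) by (simp add: d_def algebra_simps)
  show u: "xu = xv"
    unfolding assms(2,4,7,10) k n using d by algebra
  have y: "y2 = y1 - l * (x1 - x2)" using assms(1) by (simp add: ec_slope_def algebra_simps)
  have yu: "yu = d * (xs - xu) + l * (xu - x1) + y1"
    using assms(3,5) k by algebra
  have yv: "yv = d * (xt - xv) + m * (xv - x2) + y2"
    using assms(8,9,11) n by algebra
  have "d * (xs - xt) = (x1 - x3) * (l + m - d)"
    unfolding assms(2,7) using d by algebra
  moreover have "(l - m) * (xu - x2) = (x1 - x3) * (d - l - m)"
    unfolding assms(2,4) k using d by algebra
  ultimately show "yu = yv"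
    unfolding yu yv u[symmetric] using y by algebra
qed

text \<open>General position: all four sums are affine and \<open>R\<close> shares no vertical line
  with \<open>P\<close> or \<open>Q\<close>, so \<open>x3 - x1\<close> and \<open>x3 - x2\<close>
  can be cancelled. What has to be shown is that the slopes of the two bracketings have the same
  sum.\<close>

lemma add_assoc_generic:
  assumes on: "on_ec A B P" "on_ec A B Q" "on_ec A B R"
    and aff: "P = Affine x1 y1" "Q = Affine x2 y2" "R = Affine x3 y3"
    and x: "x1 \<noteq> x3" "x2 \<noteq> x3"
    and opp: "Q \<noteq> ec_neg P" "R \<noteq> ec_neg Q" "R \<noteq> ec_neg (P \<^bold>+ Q)" "Q \<^bold>+ R \<noteq> ec_neg P"
  shows "(P \<^bold>+ Q) \<^bold>+ R = P \<^bold>+ (Q \<^bold>+ R)"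
proof -
  note on' = on[unfolded aff]
  obtain l xs ys where l: "\<not> (x1 = x2 \<and> y1 = - y2)" "ec_slope A x1 y1 x2 y2 l"
      "xs = l ^ 2 - x1 - x2" "ys = l * (x1 - xs) - y1" "Affine x1 y1 \<^bold>+ Affine x2 y2 = Affine xs ys"
    using affine_add_cases[OF on'(1,2)] opp(1) aff by metis
  obtain m xt yt where m: "\<not> (x2 = x3 \<and> y2 = - y3)" "ec_slope A x2 y2 x3 y3 m"
      "xt = m ^ 2 - x2 - x3" "yt = m * (x2 - xt) - y2" "Affine x2 y2 \<^bold>+ Affine x3 y3 = Affine xt yt"
    using affine_add_cases[OF on'(2,3)] opp(2) aff by metis
  have ons: "on_ec A B (Affine xs ys)" and ont: "on_ec A B (Affine xt yt)"
    using on_add[OF on'(1,2)] on_add[OF on'(2,3)] l(5) m(5) by simp_all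
  obtain k xu yu where k: "\<not> (xs = x3 \<and> ys = - y3)" "ec_slope A xs ys x3 y3 k"
      "xu = k ^ 2 - xs - x3" "yu = k * (xs - xu) - ys" "Affine xs ys \<^bold>+ Affine x3 y3 = Affine xu yu"
    using affine_add_cases[OF ons on'(3)] opp(3) aff l(5) by metis
  obtain n xv yv where n: "\<not> (x1 = xt \<and> y1 = - yt)" "ec_slope A x1 y1 xt yt n"
      "xv = n ^ 2 - x1 - xt" "yv = n * (x1 - xv) - y1" "Affine x1 y1 \<^bold>+ Affine xt yt = Affine xv yv"
    using affine_add_cases[OF on'(1) ont] opp(4) aff m(5) by metis
  have "y3 - y1 - l * (x3 - x1) = (m - l) * (x3 - x2)"
    using l(2) m(2) unfolding ec_slope_def by algebra
  with slope_sum[OF l(2-4) k(2)]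
  have "((l + k) * (m - l)) * (x3 - x2) = (x3 - x1) * (x3 - x2)"
    by (simp only: mult.assoc)
  with x(2) have d: "(l + k) * (m - l) = x3 - x1" by simp
  have lk: "l + k = m + n"
  proof (cases "x1 = x2")
    case False
    \<comment> \<open>\<open>slope_sum\<close> for the reversed triple \<open>R\<close>,
      \<open>Q\<close>, \<open>P\<close> describes the other bracketing.\<close>
    have "(m + n) * (y1 - y3 - m * (x1 - x3)) = (x1 - x3) * (x1 - x2)"
    proof (rule slope_sum)
      show "ec_slope A x3 y3 x2 y2 m" by (rule slope_commute[OF m(2)])
      show "xt = m ^ 2 - x3 - x2" using m by simp
      show "yt = m * (x3 - xt) - y3" using m(2,4) unfolding ec_slope_def by algebra
      show "ec_slope A xt yt x1 y1 n" by (rule slope_commute[OF n(2)])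
    qed
    moreover have "y1 - y3 - m * (x1 - x3) = (l - m) * (x1 - x2)"
      using l(2) m(2) unfolding ec_slope_def by algebra
    ultimately have "((m + n) * (l - m)) * (x1 - x2) = (x1 - x3) * (x1 - x2)"
      by (simp only: mult.assoc)
    with False have "(m + n) * (l - m) = x1 - x3" by simp
    with d have "(l + k) * (m - l) = (m + n) * (m - l)" by algebra
    moreover have "m - l \<noteq> 0" using d x(1) by auto
    ultimately show ?thesis by simp
  next
    case True
    with l(1) same_x on'(1,2) have y: "y1 = y2" by metis
    \<comment> \<open>Here \<open>P = Q\<close>, so \<open>x1 - x2\<close> cannot be cancelled and
      \<open>x1 - xt\<close> takes its place. If it vanished, \<open>Q + R = P\<close> would force
      \<open>R = Infinity\<close>.\<close>
    have "xt \<noteq> x1"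
    proof
      assume xt: "xt = x1"
      have "y1 \<noteq> - yt" using n(1) xt by auto
      with ont on'(1) same_x xt have "yt = y1" by metis
      with xt m(5) True y aff have "R \<^bold>+ P = P" using add_commute[OF on(1,3)] by simp
      with add_cancel[OF on(3,1)] add_neg(1)[of P] have "R = Infinity" by simp
      with aff show False by simp
    qed
    define w where "w = y3 - y1 - l * (x3 - x1)"
    have "(l + k) * w = (x3 - x1) ^ 2"
      using slope_sum[OF l(2-4) k(2)] True by (simp add: w_def power2_eq_square)
    moreover have "(m + n) * (x1 - xt) = 2 * y1"
      using n(2) m(4) True y unfolding ec_slope_def by algebra
    moreover have "2 * y1 * w = (x3 - x1) ^ 2 * (x1 - xt)"
      using m(2,3) l(2) on' True y unfolding w_def ec_slope_def on_ec.simps by algebra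
    ultimately have "((m + n) * w) * (x1 - xt) = ((l + k) * w) * (x1 - xt)"
      by (metis mult.assoc mult.commute)
    with \<open>xt \<noteq> x1\<close> have "(m + n) * w = (l + k) * w" by simp
    moreover have "w \<noteq> 0" using \<open>(l + k) * w = _\<close> x(1) by auto
    ultimately show ?thesis by simp
  qed
  have n': "n * (x1 - xt) = y1 - yt" using n(2) by (simp add: ec_slope_def)
  from assoc_of_slope_sums[OF l(2-4) k(3,4) m(2-4) n' n(3,4) lk d]
  show ?thesis unfolding aff l(5) m(5) k(5) n(5) by simp
qed

lemma neg_add_cancel:
  assumes "on_ec A B P" "on_ec A B Q"
  shows "Q \<^bold>+ (P \<^bold>+ ec_neg Q) = P"
  using add_cancel[of P "ec_neg Q"] add_commute[of Q "P \<^bold>+ ec_neg Q"] on_add assms by simp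

text \<open>Sums that hit \<open>Infinity\<close> are handled by cancellation. Otherwise
  \<open>x1 = x3\<close> means that \<open>R\<close> is \<open>P\<close> or its negative, where
  commutativity or cancellation suffices, and \<open>x2 = x3\<close> becomes generic after
  exchanging \<open>P\<close> and \<open>R\<close>.\<close>

lemma add_assoc:
  assumes on: "on_ec A B P" "on_ec A B Q" "on_ec A B R"
  shows "(P \<^bold>+ Q) \<^bold>+ R = P \<^bold>+ (Q \<^bold>+ R)"
proof (cases "Q = ec_neg P \<or> R = ec_neg Q \<or> R = ec_neg (P \<^bold>+ Q) \<or> Q \<^bold>+ R = ec_neg P")
  case True
  have "R = P \<^bold>+ (ec_neg P \<^bold>+ R)"
    using neg_add_cancel[OF on(3,1)] add_commute[of R "ec_neg P"] on by simp
  moreover have "P \<^bold>+ (Q \<^bold>+ ec_neg (P \<^bold>+ Q)) = Infinity"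
    using neg_add_cancel[of "ec_neg P" Q] add_commute[of "ec_neg P" "ec_neg Q"]
      neg_add[OF on(1,2)] add_neg on by simp
  moreover have "P \<^bold>+ Q = ec_neg R" if "Q \<^bold>+ R = ec_neg P"
  proof -
    have "Q = ec_neg P \<^bold>+ ec_neg R" using add_cancel[OF on(2,3)] that by simp
    thus ?thesis
      using neg_add_cancel[of "ec_neg R" P] add_commute[of "ec_neg P" "ec_neg R"] on by simp
  qed
  ultimately show ?thesis
    using True add_neg add_cancel[OF on(1,2)] by auto
next
  case False
  show ?thesis
  proof (cases P; cases Q; cases R)
    fix x1 y1 x2 y2 x3 y3
    assume aff: "P = Affine x1 y1" "Q = Affine x2 y2" "R = Affine x3 y3"
    consider "x1 = x3" | "x1 \<noteq> x3" "x2 \<noteq> x3" | "x1 \<noteq> x3" "x2 = x3" by blast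
    thus ?thesis
    proof cases
      case 1
      with on aff same_x have "y3 = y1 \<or> y3 = - y1" by metis
      thus ?thesis
      proof
        assume "y3 = y1"
        with 1 aff have "R = P" by simp
        thus ?thesis using add_commute on on_add by metis
      next
        assume "y3 = - y1"
        with 1 aff have R: "R = ec_neg P" by simp
        have "(Q \<^bold>+ P) \<^bold>+ ec_neg P = P \<^bold>+ (Q \<^bold>+ ec_neg P)"
          using add_cancel[OF on(2,1)] neg_add_cancel[OF on(2,1)] by simp
        thus ?thesis using add_commute[OF on(1,2)] R by simp
      qed
    next
      case 2
      with False show ?thesis using add_assoc_generic[OF on aff] by blast
    next
      case 3
      with False have "Q \<noteq> ec_neg R" "P \<noteq> ec_neg Q" "P \<noteq> ec_neg (R \<^bold>+ Q)" "Q \<^bold>+ P \<noteq> ec_neg R"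
        using add_commute on by (metis neg_neg)+
      with 3 add_assoc_generic[OF on(3,2,1) aff(3,2,1)]
      have "(R \<^bold>+ Q) \<^bold>+ P = R \<^bold>+ (Q \<^bold>+ P)" by metis
      thus ?thesis using add_commute on on_add by metis
    qed
  qed simp_all
qed

lemma comm_group_ec: "comm_group (ec_group A B)"
proof (rule comm_groupI)
  fix P assume "P \<in> carrier (ec_group A B)"
  thus "\<exists>Q\<in>carrier (ec_group A B). Q \<otimes>\<^bsub>ec_group A B\<^esub> P = \<one>\<^bsub>ec_group A B\<^esub>"
    using add_neg(2)[of P] by (intro bexI[of _ "ec_neg P"]) (auto simp: ec_group_def)
qed (auto simp: ec_group_def on_add add_assoc intro: add_commute)

end

section \<open>Ranks of abelian groups by descent\<close>

context comm_group
begin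

text \<open>Explicit exponents on an ordered triple replace products over finite sets, so that
  relations become arithmetic on coefficient vectors.\<close>

definition lin3 :: "'a \<Rightarrow> 'a \<Rightarrow> 'a \<Rightarrow> int \<Rightarrow> int \<Rightarrow> int \<Rightarrow> 'a" where
  "lin3 x y z a b c = x [^] a \<otimes> y [^] b \<otimes> z [^] c"

definition indep3 :: "'a \<Rightarrow> 'a \<Rightarrow> 'a \<Rightarrow> bool" where
  "indep3 x y z \<longleftrightarrow> x \<in> carrier G \<and> y \<in> carrier G \<and> z \<in> carrier G \<and>
     (\<forall>a b c. lin3 x y z a b c = \<one> \<longrightarrow> a = 0 \<and> b = 0 \<and> c = 0)"

text \<open>The span of \<open>x, y, z\<close> together with the 2-torsion.\<close>

definition even_sat3 :: "'a \<Rightarrow> 'a \<Rightarrow> 'a \<Rightarrow> 'a set" where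
  "even_sat3 x y z = {w \<in> carrier G. \<exists>a b c. w [^] (2::int) = lin3 x y z (2 * a) (2 * b) (2 * c)}"

lemma lin3_closed [simp]:
  "x \<in> carrier G \<Longrightarrow> y \<in> carrier G \<Longrightarrow> z \<in> carrier G \<Longrightarrow> lin3 x y z a b c \<in> carrier G"
  by (simp add: lin3_def)

lemma lin3_mult:
  assumes "x \<in> carrier G" "y \<in> carrier G" "z \<in> carrier G"
  shows "lin3 x y z a b c \<otimes> lin3 x y z a' b' c' = lin3 x y z (a + a') (b + b') (c + c')"
  using assms by (simp add: lin3_def int_pow_mult m_ac)

lemma lin3_pow:
  assumes "x \<in> carrier G" "y \<in> carrier G" "z \<in> carrier G"
  shows "lin3 x y z a b c [^] (n::int) = lin3 x y z (n * a) (n * b) (n * c)"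
  using assms by (simp add: lin3_def int_pow_distrib int_pow_pow mult.commute)

lemma lin3_rotate:
  assumes "x \<in> carrier G" "y \<in> carrier G" "z \<in> carrier G"
  shows "lin3 y z x b c a = lin3 x y z a b c"
  using assms by (simp add: lin3_def m_ac)

lemma indep3_rotate: "indep3 x y z \<Longrightarrow> indep3 y z x"
  unfolding indep3_def by (metis lin3_rotate)

lemma even_sat3_rotate: "indep3 x y z \<Longrightarrow> even_sat3 y z x = even_sat3 x y z"
  unfolding indep3_def even_sat3_def by (auto simp: lin3_rotate)

lemma indep3_eqD:
  assumes "indep3 x y z" "lin3 x y z a b c = lin3 x y z a' b' c'"
  shows "a = a'" "b = b'" "c = c'"
proof -
  have c: "x \<in> carrier G" "y \<in> carrier G" "z \<in> carrier G"
    using assms(1) by (auto simp: indep3_def)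
  have "lin3 x y z (a - a') (b - b') (c - c') = lin3 x y z a b c \<otimes> lin3 x y z (- a') (- b') (- c')"
    using c by (simp add: lin3_mult)
  also have "\<dots> = lin3 x y z 0 0 0"
    using c by (simp add: assms(2) lin3_mult)
  also have "\<dots> = \<one>" by (simp add: lin3_def)
  finally have "lin3 x y z (a - a') (b - b') (c - c') = \<one>" .
  moreover have "i = 0 \<and> j = 0 \<and> k = 0" if "lin3 x y z i j k = \<one>" for i j k
    using assms(1) that by (simp add: indep3_def)
  ultimately have "a - a' = 0 \<and> b - b' = 0 \<and> c - c' = 0" by blast
  thus "a = a'" "b = b'" "c = c'" by simp_all
qed

lemma indep3_of_int_independent:
  assumes "int_independent G S" "card S \<ge> 3"
  obtains x y z where "indep3 x y z"
proof -
  obtain T where T: "T \<subseteq> S" "card T = 3"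
    using obtain_subset_with_card_n[OF assms(2)] by metis
  obtain x y z where xyz: "T = {x, y, z}" "x \<noteq> y" "x \<noteq> z" "y \<noteq> z"
    using T(2) unfolding card_3_iff by blast
  have S: "finite S" "S \<subseteq> carrier G" using assms(1) by (auto simp: int_independent_def)
  have car: "x \<in> carrier G" "y \<in> carrier G" "z \<in> carrier G"
    using T xyz S by auto
  have "a = 0 \<and> b = 0 \<and> c = 0" if "lin3 x y z a b c = \<one>" for a b c
  proof -
    define f where "f = (\<lambda>w. if w = x then a else if w = y then b else if w = z then c else 0)"
    have "finprod G (\<lambda>w. w [^] f w) S = finprod G (\<lambda>w. w [^] f w) T"
      using S T xyz by (intro finprod_mono_neutral_cong_right) (auto simp: f_def)
    also have "\<dots> = lin3 x y z a b c"
      using xyz car by (simp add: f_def lin3_def m_ac)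
    finally have "\<forall>w\<in>S. f w = 0"
      using assms(1) that by (simp add: int_independent_def)
    hence "f x = 0" "f y = 0" "f z = 0" using T xyz by auto
    thus ?thesis using xyz by (simp add: f_def)
  qed
  with car that show ?thesis by (auto simp: indep3_def)
qed

text \<open>On \<open>bool\<close>, \<open>\<noteq>\<close> is addition modulo 2, so
  \<open>\<chi>\<close> is a homomorphism to Z/2 and sees only the parity of an exponent.\<close>

lemma parity_hom_int_pow:
  assumes hom: "\<And>x y. x \<in> carrier G \<Longrightarrow> y \<in> carrier G \<Longrightarrow> \<chi> (x \<otimes> y) \<longleftrightarrow> \<chi> x \<noteq> \<chi> y"
    and x: "x \<in> carrier G"
  shows "\<chi> (x [^] (n::int)) \<longleftrightarrow> odd n \<and> \<chi> x"
proof -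
  have one: "\<not> \<chi> \<one>" using hom[of \<one> \<one>] by simp
  have "\<chi> (inv x) \<longleftrightarrow> \<chi> x" using hom[of x "inv x"] x one by simp
  thus ?thesis
  proof (induction n rule: int_induct[of _ 0])
    case base thus ?case using one by simp
  next
    case (step1 i)
    have "x [^] (i + 1) = x [^] i \<otimes> x" using x by (simp add: int_pow_mult)
    with step1 x show ?case by (simp add: hom) blast
  next
    case (step2 i)
    have "x [^] (i - 1) = x [^] i \<otimes> inv x" using int_pow_mult[OF x, of i "-1"] x
      by (simp add: int_pow_neg)
    with step2 x show ?case by (simp add: hom) blast
  qed
qed

lemma parity_hom_lin3:
  assumes hom: "\<And>x y. x \<in> carrier G \<Longrightarrow> y \<in> carrier G \<Longrightarrow> \<chi> (x \<otimes> y) \<longleftrightarrow> \<chi> x \<noteq> \<chi> y"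
    and "x \<in> carrier G" "y \<in> carrier G" "z \<in> carrier G"
  shows "\<chi> (lin3 x y z a b c) \<longleftrightarrow> ((odd a \<and> \<chi> x) \<noteq> (odd b \<and> \<chi> y)) \<noteq> (odd c \<and> \<chi> z)"
  using assms by (simp add: lin3_def parity_hom_int_pow[of \<chi>])

text \<open>Infinite descent: a relation between \<open>P\<close> and \<open>Q\<close> has even coefficients and can be halved.\<close>

lemma int_independent_pair:
  assumes hom1: "\<And>x y. x \<in> carrier G \<Longrightarrow> y \<in> carrier G \<Longrightarrow> \<chi>1 (x \<otimes> y) \<longleftrightarrow> \<chi>1 x \<noteq> \<chi>1 y"
    and hom2: "\<And>x y. x \<in> carrier G \<Longrightarrow> y \<in> carrier G \<Longrightarrow> \<chi>2 (x \<otimes> y) \<longleftrightarrow> \<chi>2 x \<noteq> \<chi>2 y"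
    and tors: "\<And>x. x \<in> carrier G \<Longrightarrow> x \<otimes> x = \<one> \<Longrightarrow> \<not> \<chi>1 x \<and> \<not> \<chi>2 x"
    and four: "\<And>x. x \<in> carrier G \<Longrightarrow> (x \<otimes> x) \<otimes> (x \<otimes> x) = \<one> \<Longrightarrow> x \<otimes> x = \<one>"
    and P: "P \<in> carrier G" "\<chi>1 P" "\<not> \<chi>2 P"
    and Q: "Q \<in> carrier G" "\<not> \<chi>1 Q" "\<chi>2 Q"
  shows "int_independent G {P, Q}" "P \<noteq> Q"
proof -
  define L where "L n m = P [^] (n::int) \<otimes> Q [^] (m::int)" for n m
  have car: "L n m \<in> carrier G" for n m using P Q by (simp add: L_def)
  have dbl: "L n m \<otimes> L n m = L (2 * n) (2 * m)" for n m
    using int_pow_mult[OF P(1), of n n] int_pow_mult[OF Q(1), of m m] P Q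
    by (simp add: L_def m_ac)
  \<comment> \<open>The relation is imposed on the doubled element: then \<open>L n m\<close> is
    2-torsion and the characters force even exponents, while \<open>four\<close> restores a relation
    of the same shape for the halved exponents.\<close>
  have main: "n = 0 \<and> m = 0" if "L n m \<otimes> L n m = \<one>" for n m
    using that
  proof (induction "nat \<bar>n\<bar> + nat \<bar>m\<bar>" arbitrary: n m rule: less_induct)
    case less
    from tors[OF car less(2)] P Q have "even n" "even m"
      by (simp_all add: L_def hom1 hom2 parity_hom_int_pow[of \<chi>1] parity_hom_int_pow[of \<chi>2])
    then obtain n' m' where nm: "n = 2 * n'" "m = 2 * m'" by (auto elim!: evenE)
    have "L n' m' \<otimes> L n' m' = \<one>"
      using four[OF car] less(2) by (simp add: dbl nm)
    have "n' = 0 \<and> m' = 0"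
    proof (rule ccontr)
      assume "\<not> (n' = 0 \<and> m' = 0)"
      hence "nat \<bar>n'\<bar> + nat \<bar>m'\<bar> < nat \<bar>n\<bar> + nat \<bar>m\<bar>" unfolding nm by linarith
      from less(1)[OF this] \<open>L n' m' \<otimes> L n' m' = \<one>\<close> \<open>\<not> (n' = 0 \<and> m' = 0)\<close> show False by blast
    qed
    thus ?case unfolding nm by simp
  qed
  show PQ: "P \<noteq> Q" using P Q by blast
  show "int_independent G {P, Q}"
    unfolding int_independent_def
  proof (intro conjI allI impI)
    fix c :: "'a \<Rightarrow> int" assume "(\<Otimes>x\<in>{P, Q}. x [^] c x) = \<one>"
    hence "L (c P) (c Q) = \<one>" using P Q PQ by (simp add: L_def)
    with main[of "c P" "c Q"] show "\<forall>x\<in>{P, Q}. c x = 0" by simp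
  qed (use P Q in auto)
qed

end

section \<open>Descent on triples of bounded height\<close>

text \<open>Three vectors in a plane over the field with two elements are dependent; one with
  nonzero coefficient is solved for, \<open>e\<close> and \<open>f\<close> being the other
  coefficients.\<close>

lemma three_vectors_dependent:
  fixes x1 x2 y1 y2 z1 z2 :: bool
  shows "(\<exists>e f. (x1 \<longleftrightarrow> (e \<and> y1) \<noteq> (f \<and> z1)) \<and> (x2 \<longleftrightarrow> (e \<and> y2) \<noteq> (f \<and> z2))) \<or>
    (\<exists>e f. (y1 \<longleftrightarrow> (e \<and> z1) \<noteq> (f \<and> x1)) \<and> (y2 \<longleftrightarrow> (e \<and> z2) \<noteq> (f \<and> x2))) \<or>
    (\<exists>e f. (z1 \<longleftrightarrow> (e \<and> x1) \<noteq> (f \<and> y1)) \<and> (z2 \<longleftrightarrow> (e \<and> x2) \<noteq> (f \<and> y2)))"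
  unfolding ex_bool_eq by argo

text \<open>\<open>H\<close> is a multiplicative height. Additively, \<open>halving\<close> gives
  \<open>4 r = 2 x\<close>, so \<open>r\<close> is half of \<open>x\<close> up to 2-torsion; the
  exponent 4 reflects that logarithmic heights grow fourfold under doubling.\<close>

locale height_descent = comm_group G for G (structure) +
  fixes \<chi>1 \<chi>2 :: "'a \<Rightarrow> bool" and H :: "'a \<Rightarrow> nat" and C :: nat
  assumes hom1: "x \<in> carrier G \<Longrightarrow> y \<in> carrier G \<Longrightarrow> \<chi>1 (x \<otimes> y) \<longleftrightarrow> \<chi>1 x \<noteq> \<chi>1 y"
    and hom2: "x \<in> carrier G \<Longrightarrow> y \<in> carrier G \<Longrightarrow> \<chi>2 (x \<otimes> y) \<longleftrightarrow> \<chi>2 x \<noteq> \<chi>2 y"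
    and northcott: "finite {x \<in> carrier G. H x \<le> b}"
    and parallelogram: "\<lbrakk>x \<in> carrier G; y \<in> carrier G; x \<noteq> y; x \<otimes> y \<noteq> \<one>\<rbrakk> \<Longrightarrow>
      H (x \<otimes> y) * H (x \<otimes> inv y) \<le> C * (H x ^ 2 * H y ^ 2)"
    and halving: "\<lbrakk>x \<in> carrier G; \<not> \<chi>1 x; \<not> \<chi>2 x; x \<otimes> x \<noteq> \<one>\<rbrakk> \<Longrightarrow>
      \<exists>r\<in>carrier G. (r \<otimes> r) \<otimes> (r \<otimes> r) = x \<otimes> x \<and> H r ^ 4 \<le> C * H x"
begin

text \<open>The parity \<open>e\<close> decides whether \<open>y\<close> occurs, but its sign is
  free: one of the two heights in the parallelogram inequality is at most the square root of their
  product.\<close>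

lemma signed_combination:
  assumes "x \<in> carrier G" "y \<in> carrier G" "x \<noteq> y" "x \<otimes> y \<noteq> \<one>" "H y \<le> b" "1 \<le> b" "1 \<le> C"
  obtains s :: int where "odd s \<longleftrightarrow> e" "H (x \<otimes> y [^] s) ^ 2 \<le> C * (H x ^ 2 * b ^ 2)"
proof (cases e)
  case False
  have "H x ^ 2 * 1 \<le> C * (H x ^ 2 * b ^ 2)"
    using assms(6,7) by (metis mult.left_commute mult_le_mono le_refl mult.right_neutral
        one_le_power nat_mult_1)
  with False assms(1,2) that[of 0] show ?thesis by simp
next
  case True
  have "H x ^ 2 * H y ^ 2 \<le> H x ^ 2 * b ^ 2"
    using assms(5) by (simp add: power_mono)
  with parallelogram[OF assms(1-4)]
  have le: "H (x \<otimes> y) * H (x \<otimes> inv y) \<le> C * (H x ^ 2 * b ^ 2)"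
    by (meson le_trans mult_le_mono2)
  consider "H (x \<otimes> y) ^ 2 \<le> H (x \<otimes> y) * H (x \<otimes> inv y)"
    | "H (x \<otimes> inv y) ^ 2 \<le> H (x \<otimes> y) * H (x \<otimes> inv y)"
    by (metis linear mult_le_mono1 mult_le_mono2 power2_eq_square)
  thus ?thesis
  proof cases
    case 1
    with le True assms(1,2) that[of 1] show ?thesis by simp
  next
    case 2
    with le True assms(1,2) that[of "-1"] show ?thesis by (simp add: int_pow_neg)
  qed
qed

text \<open>The relation modulo 2 lifts to \<open>d = x + s y + t z\<close>, written additively,
  with the prescribed parities and \<open>H d \<le> C * b ^ 3\<close>. Both characters vanish on
  \<open>d\<close>, so it has a half \<open>r\<close> up to 2-torsion, and
  \<open>H r ^ 4 \<le> C ^ 2 * b ^ 3 \<le> b ^ 4\<close>.\<close>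

lemma enlarge:
  assumes ind: "indep3 x y z"
    and b: "H x \<le> b" "H y \<le> b" "H z \<le> b" "1 \<le> b" "1 \<le> C" "C ^ 2 \<le> b"
    and e: "\<chi>1 x \<longleftrightarrow> (e \<and> \<chi>1 y) \<noteq> (f \<and> \<chi>1 z)" "\<chi>2 x \<longleftrightarrow> (e \<and> \<chi>2 y) \<noteq> (f \<and> \<chi>2 z)"
  obtains r where "indep3 r y z" "H r \<le> b" "even_sat3 x y z \<subset> even_sat3 r y z"
proof -
  have car [simp]: "x \<in> carrier G" "y \<in> carrier G" "z \<in> carrier G"
    using ind by (auto simp: indep3_def)
  have xe: "x = lin3 x y z 1 0 0" and ye: "y = lin3 x y z 0 1 0" and ze: "z = lin3 x y z 0 0 1"
    and one: "\<one> = lin3 x y z 0 0 0"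
    by (simp_all add: lin3_def)
  have "x \<noteq> y" using indep3_eqD(1)[OF ind, of 1 0 0 0 1 0] xe ye by auto
  moreover have "x \<otimes> y = lin3 x y z 1 1 0" by (simp add: lin3_def)
  hence "x \<otimes> y \<noteq> \<one>" using indep3_eqD(1)[OF ind, of 1 1 0 0 0 0] one by auto
  ultimately obtain s :: int where s: "odd s \<longleftrightarrow> e" "H (x \<otimes> y [^] s) ^ 2 \<le> C * (H x ^ 2 * b ^ 2)"
    using signed_combination[of x y b e] b by auto
  define w where "w = x \<otimes> y [^] s"
  have w: "w = lin3 x y z 1 s 0" by (simp add: w_def lin3_def)
  have car_w: "w \<in> carrier G" by (simp add: w_def)
  have "w \<noteq> z" using indep3_eqD(1)[OF ind, of 1 s 0 0 0 1] ze w by auto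
  moreover have "w \<otimes> z = lin3 x y z 1 s 1" by (simp add: w_def lin3_def)
  hence "w \<otimes> z \<noteq> \<one>" using indep3_eqD(1)[OF ind, of 1 s 1 0 0 0] one by auto
  ultimately obtain t :: int where t: "odd t \<longleftrightarrow> f" "H (w \<otimes> z [^] t) ^ 2 \<le> C * (H w ^ 2 * b ^ 2)"
    using signed_combination[of w z b f] b car_w by auto
  define d where "d = lin3 x y z 1 s t"
  have d: "d = w \<otimes> z [^] t" by (simp add: d_def w_def lin3_def)
  have car_d [simp]: "d \<in> carrier G" by (simp add: d_def)
  have "H d ^ 2 \<le> C * (H w ^ 2 * b ^ 2)" using t d by simp
  also have "H w ^ 2 \<le> C * (b ^ 2 * b ^ 2)"
    using s(2) b(1) unfolding w_def[symmetric]
    by (meson le_trans mult_le_mono1 mult_le_mono2 power_mono zero_le)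
  hence "C * (H w ^ 2 * b ^ 2) \<le> C * ((C * (b ^ 2 * b ^ 2)) * b ^ 2)"
    by (intro mult_le_mono2 mult_le_mono1)
  also have "\<dots> = (C * b ^ 3) ^ 2" by (simp add: power_mult_distrib power2_eq_square power3_eq_cube)
  finally have Hd: "H d \<le> C * b ^ 3" by (simp add: power2_nat_le_eq_le)
  have "\<not> \<chi>1 d" "\<not> \<chi>2 d"
    using e s(1) t(1) by (auto simp: d_def parity_hom_lin3[of \<chi>1, OF hom1] parity_hom_lin3[of \<chi>2, OF hom2])
  moreover have dd: "d \<otimes> d = lin3 x y z 2 (2 * s) (2 * t)"
    by (simp add: d_def lin3_mult)
  hence "d \<otimes> d \<noteq> \<one>" using indep3_eqD(1)[OF ind, of 2 "2 * s" "2 * t" 0 0 0] one by auto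
  ultimately obtain r where r: "r \<in> carrier G" "(r \<otimes> r) \<otimes> (r \<otimes> r) = d \<otimes> d" "H r ^ 4 \<le> C * H d"
    using halving[of d] by auto
  have "H r ^ 4 \<le> C * (C * b ^ 3)" using r(3) Hd by (meson le_trans mult_le_mono2)
  also have "\<dots> = C ^ 2 * b ^ 3" by (simp add: power2_eq_square)
  also have "\<dots> \<le> b * b ^ 3" using b by simp
  also have "\<dots> = b ^ 4" by (simp add: power_numeral_reduce)
  finally have Hr: "H r \<le> b" using power_mono_iff[of "H r" b 4] by simp
  have "r [^] (4::int) = (r \<otimes> r) \<otimes> (r \<otimes> r)"
    using r(1) by (simp add: int_pow_mult[of r 1 1, simplified] int_pow_mult[of r 2 2, simplified])
  hence r4: "r [^] (4::int) = lin3 x y z 2 (2 * s) (2 * t)" using r(2) dd by simp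
  \<comment> \<open>Since \<open>4 r = 2 d\<close> additively, combinations with a multiple of
    \<open>4 r\<close> can be read in the old triple. Relations in the new triple are multiplied by
    4 to reach this form.\<close>
  have subst: "lin3 r y z (4 * i) j k = lin3 x y z (2 * i) (2 * s * i + j) (2 * t * i + k)" for i j k
  proof -
    have "lin3 r y z (4 * i) j k = (r [^] (4::int)) [^] i \<otimes> lin3 x y z 0 j k"
      using r(1) by (simp add: lin3_def int_pow_pow m_ac)
    thus ?thesis by (simp add: r4 lin3_pow lin3_mult mult_ac)
  qed
  have ind': "indep3 r y z"
    unfolding indep3_def
  proof (intro conjI allI impI)
    fix i j k assume "lin3 r y z i j k = \<one>"
    hence "lin3 r y z i j k [^] (4::int) = \<one>" by simp
    hence "lin3 x y z (2 * i) (2 * s * i + 4 * j) (2 * t * i + 4 * k) = lin3 x y z 0 0 0"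
      using r(1) one by (simp add: lin3_pow subst)
    from indep3_eqD[OF ind this] show "i = 0" "j = 0" "k = 0" by auto
  qed (use r in auto)
  have "even_sat3 x y z \<subseteq> even_sat3 r y z"
  proof
    fix v assume "v \<in> even_sat3 x y z"
    then obtain i j k where v: "v \<in> carrier G" "v [^] (2::int) = lin3 x y z (2 * i) (2 * j) (2 * k)"
      by (auto simp: even_sat3_def)
    have "v [^] (2::int) = lin3 r y z (2 * (2 * i)) (2 * (j - s * i)) (2 * (k - t * i))"
      using subst[of i "2 * (j - s * i)" "2 * (k - t * i)"] by (simp add: v(2) algebra_simps)
    with v(1) show "v \<in> even_sat3 r y z" unfolding even_sat3_def by blast
  qed
  moreover have "r \<in> even_sat3 r y z"
  proof -
    have "r [^] (2::int) = lin3 r y z (2 * 1) (2 * 0) (2 * 0)" using r(1) by (simp add: lin3_def)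
    thus ?thesis unfolding even_sat3_def using r(1) by blast
  qed
  moreover have "r \<notin> even_sat3 x y z"
  proof
    assume "r \<in> even_sat3 x y z"
    then obtain i j k where "r [^] (2::int) = lin3 x y z (2 * i) (2 * j) (2 * k)"
      by (auto simp: even_sat3_def)
    hence "(r [^] (2::int)) [^] (2::int) = lin3 x y z (4 * i) (4 * j) (4 * k)"
      by (simp add: lin3_pow)
    hence "lin3 x y z 2 (2 * s) (2 * t) = lin3 x y z (4 * i) (4 * j) (4 * k)"
      using r(1) r4 by (simp add: int_pow_pow)
    \<comment> \<open>Comparing coefficients of \<open>x\<close> gives
      \<open>2 = 4 * i\<close>.\<close>
    from indep3_eqD(1)[OF ind this] show False by presburger
  qed
  ultimately have "even_sat3 x y z \<subset> even_sat3 r y z" by blast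
  with ind' Hr that show ?thesis by blast
qed

text \<open>Finitely many independent triples have height at most \<open>b\<close>, so one of them
  has a maximal saturated span. The dependence of its character values lets \<open>enlarge\<close>
  produce a larger span below the same bound.\<close>

lemma not_indep3: "\<not> indep3 x y z"
proof
  assume ind: "indep3 x y z"
  \<comment> \<open>The bound covers the given triple and also the square of the constant, raised to
    at least 1, as \<open>enlarge\<close> requires.\<close>
  define b where "b = Max {H x, H y, H z, 1, (max 1 C) ^ 2}"
  have b: "H x \<le> b" "H y \<le> b" "H z \<le> b" "1 \<le> b" "(max 1 C) ^ 2 \<le> b"
    unfolding b_def by (auto intro!: Max_ge simp del: Max_insert)
  interpret D: height_descent G \<chi>1 \<chi>2 H "max 1 C"
  proof
    fix x y assume xy: "x \<in> carrier G" "y \<in> carrier G" "x \<noteq> y" "x \<otimes> y \<noteq> \<one>"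
    have "C * (H x ^ 2 * H y ^ 2) \<le> max 1 C * (H x ^ 2 * H y ^ 2)" by (intro mult_le_mono1) simp
    with parallelogram[OF xy]
    show "H (x \<otimes> y) * H (x \<otimes> inv y) \<le> max 1 C * (H x ^ 2 * H y ^ 2)" by linarith
  next
    fix x assume x: "x \<in> carrier G" "\<not> \<chi>1 x" "\<not> \<chi>2 x" "x \<otimes> x \<noteq> \<one>"
    have "C * H x \<le> max 1 C * H x" by (intro mult_le_mono1) simp
    with halving[OF x]
    show "\<exists>r\<in>carrier G. (r \<otimes> r) \<otimes> (r \<otimes> r) = x \<otimes> x \<and> H r ^ 4 \<le> max 1 C * H x"
      by (meson le_trans)
  qed (simp_all add: hom1 hom2 northcott)
  define F where "F = {x \<in> carrier G. H x \<le> b}"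
  define T where "T = {(x, y, z). indep3 x y z \<and> x \<in> F \<and> y \<in> F \<and> z \<in> F}"
  define U where "U = (\<lambda>(x, y, z). even_sat3 x y z) ` T"
  have "T \<subseteq> F \<times> F \<times> F" by (auto simp: T_def)
  moreover have "finite F" using northcott by (simp add: F_def)
  ultimately have "finite T" by (metis finite_cartesian_product finite_subset)
  hence "finite U" by (simp add: U_def)
  moreover have "(x, y, z) \<in> T" using ind b by (auto simp: T_def F_def indep3_def)
  hence "U \<noteq> {}" by (auto simp: U_def)
  ultimately obtain M where M: "M \<in> U" "\<And>N. N \<in> U \<Longrightarrow> M \<subseteq> N \<Longrightarrow> M = N"
    using finite_has_maximal[of U] by blast
  have step: False
    if rel: "indep3 x y z" "x \<in> F" "y \<in> F" "z \<in> F" "even_sat3 x y z = M"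
      "\<chi>1 x \<longleftrightarrow> (e \<and> \<chi>1 y) \<noteq> (f \<and> \<chi>1 z)" "\<chi>2 x \<longleftrightarrow> (e \<and> \<chi>2 y) \<noteq> (f \<and> \<chi>2 z)" for x y z e f
  proof -
    obtain r where r: "indep3 r y z" "H r \<le> b" "even_sat3 x y z \<subset> even_sat3 r y z"
      by (rule D.enlarge[OF rel(1) _ _ _ b(4) _ b(5) rel(6,7)]) (use rel in \<open>auto simp: F_def\<close>)
    hence "(r, y, z) \<in> T" using rel by (auto simp: T_def F_def indep3_def)
    hence "even_sat3 r y z \<in> U" by (force simp: U_def)
    with M(2)[of "even_sat3 r y z"] r(3) rel(5) show False by blast
  qed
  obtain x y z where T: "(x, y, z) \<in> T" "M = even_sat3 x y z" using M(1) by (auto simp: U_def)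
  have i1: "indep3 x y z" and F: "x \<in> F" "y \<in> F" "z \<in> F" using T(1) by (auto simp: T_def)
  have i2: "indep3 y z x" and i3: "indep3 z x y" using i1 indep3_rotate by blast+
  have m: "even_sat3 x y z = M" "even_sat3 y z x = M" "even_sat3 z x y = M"
    using T(2) even_sat3_rotate i1 i2 by auto
  have "(\<exists>e f. (\<chi>1 x \<longleftrightarrow> (e \<and> \<chi>1 y) \<noteq> (f \<and> \<chi>1 z)) \<and> (\<chi>2 x \<longleftrightarrow> (e \<and> \<chi>2 y) \<noteq> (f \<and> \<chi>2 z))) \<or>
    (\<exists>e f. (\<chi>1 y \<longleftrightarrow> (e \<and> \<chi>1 z) \<noteq> (f \<and> \<chi>1 x)) \<and> (\<chi>2 y \<longleftrightarrow> (e \<and> \<chi>2 z) \<noteq> (f \<and> \<chi>2 x))) \<or>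
    (\<exists>e f. (\<chi>1 z \<longleftrightarrow> (e \<and> \<chi>1 x) \<noteq> (f \<and> \<chi>1 y)) \<and> (\<chi>2 z \<longleftrightarrow> (e \<and> \<chi>2 x) \<noteq> (f \<and> \<chi>2 y)))"
    by (rule three_vectors_dependent)
  thus False
  proof (elim disjE exE conjE, goal_cases)
    case (1 e f) thus ?case by (rule step[OF i1 F m(1)])
  next
    case (2 e f) thus ?case by (rule step[OF i2 F(2,3,1) m(2)])
  next
    case (3 e f) thus ?case by (rule step[OF i3 F(3,1,2) m(3)])
  qed
qed

lemma rank_le_2: "abelian_group_rank G \<le> 2"
  unfolding abelian_group_rank_def
proof (rule SUP_least)
  fix S assume "S \<in> {S. int_independent G S}"
  hence "\<not> card S \<ge> 3" using indep3_of_int_independent not_indep3 by (metis mem_Collect_eq)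
  hence "enat (card S) \<le> enat 2" by simp
  thus "enat (card S) \<le> 2" by (simp add: numeral_eq_enat)
qed

end

section \<open>Two-descent\<close>

text \<open>The 2-descent map \<open>x - e\<close> modulo squares. At the point
  \<open>(e, 0)\<close> the vanishing value is replaced by the derivative of the cubic, the product
  of the differences of \<open>e\<close> to the other two roots.\<close>

definition descent_map :: "'a::field \<Rightarrow> 'a \<Rightarrow> 'a ec_point \<Rightarrow> 'a" where
  "descent_map A e P = (case P of Infinity \<Rightarrow> 1
     | Affine x y \<Rightarrow> if x = e then 3 * e ^ 2 + A else x - e)"

lemma descent_map_Infinity [simp]: "descent_map A e Infinity = 1"
  by (simp add: descent_map_def)

lemma descent_map_Affine:
  "descent_map A e (Affine x y) = (if x = e then 3 * e ^ 2 + A else x - e)"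
  by (simp add: descent_map_def)

context elliptic_curve
begin

lemma descent_map_nonzero:
  assumes "e ^ 3 + A * e + B = 0"
  shows "descent_map A e P \<noteq> 0"
  using nonsingular[OF assms] by (cases P) (auto simp: descent_map_Affine)

text \<open>On the line \<open>y = l (x - e)\<close> the cubic minus
  \<open>l ^ 2 * (x - e) ^ 2\<close> has roots \<open>e\<close>, \<open>x2\<close>,
  \<open>x3\<close>; cancelling \<open>x - e\<close> and evaluating at \<open>e\<close> leaves the
  derivative.\<close>

lemma slope_through_root:
  assumes "ec_slope A e 0 x2 y2 l" "x3 = l ^ 2 - e - x2"
  shows "(x2 - e) * (x3 - e) = 3 * e ^ 2 + A"
  using assms unfolding ec_slope_def by algebra

text \<open>The cubic minus the square of the line factors as
  \<open>(x - x1) * (x - x2) * (x - x3)\<close>; at \<open>x = e\<close> the cubic vanishes and the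
  product is a square up to sign. The case distinction treats points with x-coordinate
  \<open>e\<close>.\<close>

lemma descent_map_add:
  assumes e: "e ^ 3 + A * e + B = 0" and on: "on_ec A B P" "on_ec A B Q"
  shows "\<exists>z. descent_map A e P * descent_map A e Q * descent_map A e (P \<^bold>+ Q) = z ^ 2"
proof (cases P; cases Q)
  fix x1 y1 x2 y2 assume PQ: "P = Affine x1 y1" "Q = Affine x2 y2"
  from on[unfolded PQ] show ?thesis
  proof (cases rule: affine_add_cases)
    case 1
    hence "descent_map A e Q = descent_map A e P" by (simp add: PQ descent_map_Affine)
    moreover have "P \<^bold>+ Q = Infinity" using 1 by (simp add: PQ)
    ultimately show ?thesis by (auto simp: power2_eq_square)
  next
    case (2 l x3 y3)
    note l = 2(2) and x3 = 2(3)
    have on3: "on_ec A B (Affine x3 y3)" using on_add[OF on] 2(5) by (simp add: PQ)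
    have y0: "y = 0" if "on_ec A B (Affine e y)" for y
      using that e by simp
    have l3: "ec_slope A x3 y3 x2 (- y2) (- l)" by (rule slope_neg_sum[OF 2(2-4)])
    have nz: "3 * e ^ 2 + A \<noteq> 0" by (rule nonsingular[OF e])
    have 1: "(x2 - e) * (x3 - e) = 3 * e ^ 2 + A" if "x1 = e"
      using slope_through_root[of e x2 y2 l x3] l x3 y0[of y1] on that by (auto simp: PQ)
    have 2: "(x1 - e) * (x3 - e) = 3 * e ^ 2 + A" if "x2 = e"
      using slope_through_root[of e x1 y1 l x3] slope_commute[OF l] x3 y0[of y2] on that
      by (auto simp: PQ)
    have 3: "(x2 - e) * (x1 - e) = 3 * e ^ 2 + A" if "x3 = e"
    proof (rule slope_through_root)
      show "ec_slope A e 0 x2 (- y2) (- l)" using l3 on3 y0[of y3] that by simp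
      show "x1 = (- l) ^ 2 - e - x2" using x3 that by (simp add: algebra_simps)
    qed
    have 4: "(x1 - e) * (x2 - e) * (x3 - e) = (y1 + l * (e - x1)) ^ 2"
    proof -
      define c where "c = y1 - l * x1"
      have "x1 * x2 + (x1 + x2) * x3 = A - 2 * l * c"
        unfolding c_def using l x3 unfolding ec_slope_def by algebra
      moreover have "x1 * x2 * x3 = c ^ 2 - B"
      proof -
        have "x1 * x2 * x3 = x1 ^ 3 - l ^ 2 * x1 ^ 2 + (A - 2 * l * c) * x1"
          unfolding calculation[symmetric] x3 by algebra
        also have "\<dots> = c ^ 2 - B"
          using on(1) unfolding PQ on_ec.simps c_def by algebra
        finally show ?thesis .
      qed
      moreover have "y1 + l * (e - x1) = c + l * e" by (simp add: c_def algebra_simps)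
      ultimately show ?thesis using x3 e by algebra
    qed
    \<comment> \<open>At most one of the three x-coordinates is \<open>e\<close>, since two would
      make the nonzero derivative vanish.\<close>
    consider "x1 = e" "x2 \<noteq> e" "x3 \<noteq> e" | "x1 \<noteq> e" "x2 = e" "x3 \<noteq> e"
      | "x1 \<noteq> e" "x2 \<noteq> e" "x3 = e" | "x1 \<noteq> e" "x2 \<noteq> e" "x3 \<noteq> e"
      using 1 2 3 nz by fastforce
    moreover have "P \<^bold>+ Q = Affine x3 y3" using \<open>Affine x1 y1 \<^bold>+ _ = _\<close> by (simp add: PQ)
    ultimately show ?thesis
    proof cases
      case a: 1
      have "(3 * e ^ 2 + A) * (x2 - e) * (x3 - e) = (3 * e ^ 2 + A) ^ 2"
        using 1[OF a(1)] by (simp add: power2_eq_square mult.assoc)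
      thus ?thesis using a \<open>P \<^bold>+ Q = _\<close> by (auto simp: PQ descent_map_Affine)
    next
      case a: 2
      have "(x1 - e) * (3 * e ^ 2 + A) * (x3 - e) = (3 * e ^ 2 + A) ^ 2"
        using 2[OF a(2)] by (simp add: power2_eq_square mult_ac)
      thus ?thesis using a \<open>P \<^bold>+ Q = _\<close> by (auto simp: PQ descent_map_Affine)
    next
      case a: 3
      have "(x1 - e) * (x2 - e) * (3 * e ^ 2 + A) = (3 * e ^ 2 + A) ^ 2"
        using 3[OF a(3)] by (simp add: power2_eq_square mult_ac)
      thus ?thesis using a \<open>P \<^bold>+ Q = _\<close> by (auto simp: PQ descent_map_Affine)
    next
      case a: 4
      thus ?thesis using 4 \<open>P \<^bold>+ Q = _\<close> by (auto simp: PQ descent_map_Affine)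
    qed
  qed
qed (auto simp: power2_eq_square intro: exI[of _ 1])

end

section \<open>Valuations of rational numbers and a criterion for squares\<close>

definition rat_val :: "int \<Rightarrow> rat \<Rightarrow> int" where
  "rat_val q x = (case quotient_of x of (a, b) \<Rightarrow> int (multiplicity q a) - int (multiplicity q b))"

lemma rat_val_frac:
  assumes "prime q" "a \<noteq> 0" "b \<noteq> 0"
  shows "rat_val q (of_int a / of_int b) = int (multiplicity q a) - int (multiplicity q b)"
proof -
  obtain n d where nd: "quotient_of (of_int a / of_int b) = (n, d)" by force
  have eq: "(of_int a / of_int b :: rat) = of_int n / of_int d" and "d > 0"
    using quotient_of_div[OF nd] quotient_of_denom_pos[OF nd] by auto
  with assms(2,3) have "n \<noteq> 0" by auto
  from eq \<open>d > 0\<close> assms(3) have "(of_int (a * d) :: rat) = of_int (n * b)"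
    by (simp add: frac_eq_eq)
  hence "multiplicity q (a * d) = multiplicity q (n * b)" by (simp only: of_int_eq_iff)
  hence "multiplicity q a + multiplicity q d = multiplicity q n + multiplicity q b"
    using assms \<open>d > 0\<close> \<open>n \<noteq> 0\<close> by (simp add: prime_elem_multiplicity_mult_distrib[OF prime_imp_prime_elem])
  thus ?thesis by (simp add: rat_val_def nd)
qed

lemma rat_frac_cases:
  fixes x y :: rat
  assumes "x \<noteq> 0" "y \<noteq> 0"
  obtains a b c where "a \<noteq> 0" "b \<noteq> 0" "c \<noteq> 0" "x = of_int a / of_int c" "y = of_int b / of_int c"
proof -
  obtain a c where x: "quotient_of x = (a, c)" by force
  obtain b d where y: "quotient_of y = (b, d)" by force
  have "x = of_int a / of_int c" "c > 0" "y = of_int b / of_int d" "d > 0"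
    using quotient_of_div[OF x] quotient_of_denom_pos[OF x]
      quotient_of_div[OF y] quotient_of_denom_pos[OF y] by auto
  with assms that[of "a * d" "b * c" "c * d"] show ?thesis by (auto simp: field_simps)
qed

lemma rat_val_mult:
  assumes "prime q" "x \<noteq> 0" "y \<noteq> 0"
  shows "rat_val q (x * y) = rat_val q x + rat_val q y"
proof -
  obtain a b c where abc: "a \<noteq> 0" "b \<noteq> 0" "c \<noteq> 0" "x = of_int a / of_int c" "y = of_int b / of_int c"
    using rat_frac_cases[OF assms(2,3)] by blast
  have "x * y = of_int (a * b) / of_int (c * c)" by (simp add: abc)
  hence "rat_val q (x * y) = int (multiplicity q (a * b)) - int (multiplicity q (c * c))"
    using rat_val_frac[OF assms(1), of "a * b" "c * c"] abc by simp
  thus ?thesis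
    using abc assms(1) by (simp add: rat_val_frac prime_elem_multiplicity_mult_distrib[OF prime_imp_prime_elem])
qed

lemma rat_val_of_int: "prime q \<Longrightarrow> a \<noteq> 0 \<Longrightarrow> rat_val q (of_int a) = int (multiplicity q a)"
  using rat_val_frac[of q a 1] by simp

lemma rat_val_square: "prime q \<Longrightarrow> x \<noteq> 0 \<Longrightarrow> rat_val q (x ^ 2) = 2 * rat_val q x"
  by (simp add: power2_eq_square rat_val_mult)

lemma rat_val_minus:
  assumes "prime q" "x \<noteq> 0"
  shows "rat_val q (- x) = rat_val q x"
proof -
  have "2 * rat_val q (- x) = 2 * rat_val q x"
    using assms rat_val_square[of q x] rat_val_square[of q "- x"] by simp
  thus ?thesis by simp
qed

lemma rat_val_add:
  assumes "prime q" "x \<noteq> 0" "y \<noteq> 0" "rat_val q x < rat_val q y"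
  shows "x + y \<noteq> 0" "rat_val q (x + y) = rat_val q x"
proof -
  obtain a b c where abc: "a \<noteq> 0" "b \<noteq> 0" "c \<noteq> 0" "x = of_int a / of_int c" "y = of_int b / of_int c"
    using rat_frac_cases[OF assms(2,3)] by blast
  have lt: "multiplicity q a < multiplicity q b"
    using assms(1,4) abc by (simp add: rat_val_frac)
  show nz: "x + y \<noteq> 0"
  proof
    assume "x + y = 0"
    hence "y = - x" by (simp add: add_eq_0_iff)
    with assms rat_val_minus show False by simp
  qed
  have xy: "x + y = of_int (a + b) / of_int c" by (simp add: abc add_divide_distrib)
  with nz have "a + b \<noteq> 0" by auto
  have "rat_val q (x + y) = int (multiplicity q (a + b)) - int (multiplicity q c)"
    unfolding xy by (rule rat_val_frac) (use assms \<open>a + b \<noteq> 0\<close> abc in auto)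
  moreover have "multiplicity q (a + b) = multiplicity q a"
    by (rule multiplicity_sum_lt[OF lt abc(1,2)])
  ultimately show "rat_val q (x + y) = rat_val q x"
    using abc assms(1) by (simp add: rat_val_frac)
qed

lemma rat_square_if_even_val:
  assumes "x > 0" "\<And>q. prime q \<Longrightarrow> even (rat_val q x)"
  shows "\<exists>z. x = z ^ 2"
proof -
  obtain n d where nd: "quotient_of x = (n, d)" by force
  have x: "x = of_int n / of_int d" and d: "d > 0"
    using quotient_of_div[OF nd] quotient_of_denom_pos[OF nd] by auto
  with assms(1) have n: "n > 0" by (simp add: zero_less_divide_iff)
  \<comment> \<open>The quotient \<open>n / d\<close> and the integer \<open>n * d\<close> differ by
    the square \<open>d ^ 2\<close>.\<close>
  have "2 dvd multiplicity q (n * d)" if q: "prime q" for q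
  proof -
    have "even (int (multiplicity q n) - int (multiplicity q d))"
      using assms(2)[OF q] q n d by (simp add: x rat_val_frac)
    hence "even (int (multiplicity q n + multiplicity q d))" by simp
    thus ?thesis using q n d by (simp add: prime_elem_multiplicity_mult_distrib[OF prime_imp_prime_elem])
  qed
  hence "is_nth_power 2 (normalize (n * d))"
    by (subst is_nth_power_conv_multiplicity) auto
  then obtain m where "n * d = m ^ 2" using n d by (auto elim!: is_nth_powerE)
  hence "of_int n * of_int d = (of_int m :: rat) ^ 2" by (metis of_int_mult of_int_power)
  hence "x = (of_int m / of_int d) ^ 2"
    using d by (simp add: x field_simps power2_eq_square)
  thus ?thesis by blast
qed

text \<open>
  At a prime where \<open>a\<close> and \<open>b\<close> are units, the factors \<open>x\<close>, \<open>x + a\<close>, \<open>x + b\<close> either share the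
  same negative valuation or, when \<open>x\<close> is divisible by the prime, the other two are units.
\<close>

lemma even_val_of_square_product:
  assumes q: "prime q" and nz: "x \<noteq> 0" "a \<noteq> 0" "b \<noteq> 0" "y \<noteq> 0"
    and unit: "rat_val q a = 0" "rat_val q b = 0"
    and eq: "x * (x + a) * (x + b) = y ^ 2"
  shows "even (rat_val q x)"
proof -
  have nz': "x + a \<noteq> 0" "x + b \<noteq> 0" using eq nz(4) by auto
  have sum: "rat_val q x + rat_val q (x + a) + rat_val q (x + b) = 2 * rat_val q y"
    using arg_cong[OF eq, of "rat_val q"] nz nz' q by (simp add: rat_val_mult rat_val_square)
  consider "rat_val q x < 0" | "rat_val q x = 0" | "rat_val q x > 0" by linarith
  thus ?thesis
  proof cases
    case 1
    hence "rat_val q (x + a) = rat_val q x" "rat_val q (x + b) = rat_val q x"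
      using rat_val_add(2)[OF q] nz unit by auto
    with sum show ?thesis by presburger
  next
    case 3
    hence "rat_val q (a + x) = 0" "rat_val q (b + x) = 0"
      using rat_val_add(2)[OF q] nz unit by auto
    with sum show ?thesis by (simp add: add.commute)
  qed simp
qed

lemma square_product_parity:
  assumes "prime q" "x * y * w = z ^ 2" "x \<noteq> 0" "y \<noteq> 0" "w \<noteq> 0"
  shows "odd (rat_val q w) \<longleftrightarrow> odd (rat_val q x) \<noteq> odd (rat_val q y)"
proof -
  have "z \<noteq> 0" using assms by auto
  hence "rat_val q (x * y * w) = 2 * rat_val q z" using assms(1,2) by (simp add: rat_val_square)
  moreover have "rat_val q (x * y * w) = rat_val q x + rat_val q y + rat_val q w"
    using assms(1,3-5) by (simp add: rat_val_mult)
  ultimately show ?thesis by presburger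
qed

lemma square_product_sign:
  fixes x y w :: rat
  assumes "x * y * w = z ^ 2" "x \<noteq> 0" "y \<noteq> 0" "w \<noteq> 0"
  shows "w < 0 \<longleftrightarrow> (x < 0) \<noteq> (y < 0)"
proof -
  have "x * y * w > 0" using assms by (metis divisors_zero zero_less_power2 power_zero_numeral)
  thus ?thesis using assms(2-4) by (auto simp: zero_less_mult_iff mult_less_0_iff)
qed

section \<open>The curve \<open>y^2 = x^3 - p^2 x\<close>: parity characters and halving of
  points\<close>

locale congruent_curve =
  fixes p :: nat
  assumes p: "prime p" "odd p"
begin

definition cp :: rat where "cp = of_nat p"

lemma cp_pos: "cp > 0"
  using p(1) by (simp add: cp_def prime_gt_0_nat)

sublocale elliptic_curve "- (cp ^ 2)" 0
proof
  fix x assume "x ^ 3 + - (cp ^ 2) * x + 0 = 0"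
  hence "x * (x ^ 2 - cp ^ 2) = 0" by (simp add: algebra_simps power2_eq_square power3_eq_cube)
  thus "3 * x ^ 2 + - (cp ^ 2) \<noteq> 0" using cp_pos by auto
qed simp

abbreviation cadd (infixl "\<^bold>+" 65) where "P \<^bold>+ Q \<equiv> ec_add (- (cp ^ 2)) P Q"
abbreviation E where "E \<equiv> ec_group (- (cp ^ 2)) 0"
abbreviation on where "on \<equiv> on_ec (- (cp ^ 2)) 0"
abbreviation d0 where "d0 \<equiv> descent_map (- (cp ^ 2)) 0"
abbreviation dp where "dp \<equiv> descent_map (- (cp ^ 2)) cp"

text \<open>
  \<open>chi1\<close> and \<open>chi2\<close> combine the parities so that they vanish on the 2-torsion, whose images under
  \<open>(d0, dp)\<close> are generated by the square classes of \<open>(-1, -p)\<close> and \<open>(p, 2)\<close>.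
\<close>

definition chi1 :: "rat ec_point \<Rightarrow> bool" where
  "chi1 P \<longleftrightarrow> odd (rat_val 2 (dp P)) \<noteq> odd (rat_val (int p) (d0 P))"

definition chi2 :: "rat ec_point \<Rightarrow> bool" where
  "chi2 P \<longleftrightarrow> (d0 P < 0) \<noteq> odd (rat_val (int p) (dp P))"

lemma prime_ip: "prime (int p)"
  using p(1) by simp

lemma prime_two: "prime (2::int)"
  by simp

lemma roots: "0 ^ 3 + - (cp ^ 2) * 0 + 0 = 0" "cp ^ 3 + - (cp ^ 2) * cp + 0 = 0"
  by (simp_all add: power2_eq_square power3_eq_cube)

lemmas d_nonzero [simp] = descent_map_nonzero[OF roots(1)] descent_map_nonzero[OF roots(2)]

lemma d_add_parity:
  assumes "on P" "on Q" "prime q"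
  shows "even (rat_val q (d0 (P \<^bold>+ Q))) \<longleftrightarrow> even (rat_val q (d0 P)) = even (rat_val q (d0 Q))"
    and "even (rat_val q (dp (P \<^bold>+ Q))) \<longleftrightarrow> even (rat_val q (dp P)) = even (rat_val q (dp Q))"
  using descent_map_add[OF roots(1) assms(1,2)] descent_map_add[OF roots(2) assms(1,2)]
    square_product_parity[OF assms(3)] d_nonzero by metis+

lemma d_add_sign:
  assumes "on P" "on Q"
  shows "d0 (P \<^bold>+ Q) < 0 \<longleftrightarrow> (d0 P < 0) \<noteq> (d0 Q < 0)"
  using descent_map_add[OF roots(1) assms] square_product_sign d_nonzero by metis

lemma chi_add:
  assumes "on P" "on Q"
  shows "chi1 (P \<^bold>+ Q) \<longleftrightarrow> chi1 P \<noteq> chi1 Q" "chi2 (P \<^bold>+ Q) \<longleftrightarrow> chi2 P \<noteq> chi2 Q"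
  unfolding chi1_def chi2_def d_add_parity[OF assms prime_ip] d_add_sign[OF assms]
    d_add_parity[OF assms prime_two]
  by argo+

lemma rat_val_cp: "rat_val (int p) cp = 1" "rat_val (int p) 2 = 0" "rat_val 2 2 = 1"
    "rat_val 2 cp = 0" "prime q \<Longrightarrow> q \<noteq> int p \<Longrightarrow> rat_val q cp = 0"
    "prime q \<Longrightarrow> q \<noteq> 2 \<Longrightarrow> rat_val q 2 = 0"
proof -
  have cp: "cp = of_int (int p)" by (simp add: cp_def)
  have p2: "int p \<noteq> 2" using p(2) by auto
  show 1: "prime q \<Longrightarrow> q \<noteq> int p \<Longrightarrow> rat_val q cp = 0" for q
    unfolding cp using prime_ip by (subst rat_val_of_int) (auto simp: prime_multiplicity_other)
  show 2: "prime q \<Longrightarrow> q \<noteq> 2 \<Longrightarrow> rat_val q 2 = 0" for q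
    using rat_val_of_int[of q 2] by (simp add: prime_multiplicity_other)
  show "rat_val (int p) cp = 1"
    unfolding cp using prime_ip by (subst rat_val_of_int) auto
  show "rat_val (int p) 2 = 0" using 2[OF prime_ip p2] .
  show "rat_val 2 cp = 0" using 1[of 2] p2 by simp
  show "rat_val 2 2 = 1" using rat_val_of_int[of 2 2] by simp
qed

lemma on_cases: "on (Affine x y) \<longleftrightarrow> y ^ 2 = x * (x - cp) * (x + cp)"
  by (simp add: algebra_simps power2_eq_square power3_eq_cube)

lemma two_torsion_iff:
  assumes "on P"
  shows "P \<^bold>+ P = Infinity \<longleftrightarrow> P \<in> {Infinity, Affine 0 0, Affine cp 0, Affine (- cp) 0}"
proof (cases P)
  case (Affine x y)
  have "P \<^bold>+ P = Infinity \<longleftrightarrow> y = 0"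
  proof
    assume "P \<^bold>+ P = Infinity"
    with assms show "y = 0"
      unfolding Affine using affine_add_cases[of x y x y] by fastforce
  next
    assume "y = 0"
    thus "P \<^bold>+ P = Infinity" using add_neg(1)[of P] by (simp add: Affine)
  qed
  also have "\<dots> \<longleftrightarrow> P \<in> {Infinity, Affine 0 0, Affine cp 0, Affine (- cp) 0}"
    using assms unfolding Affine on_cases by (auto simp: eq_neg_iff_add_eq_0)
  finally show ?thesis .
qed simp

lemma d_torsion:
  "d0 (Affine 0 0) = - (cp ^ 2)" "d0 (Affine cp 0) = cp" "d0 (Affine (- cp) 0) = - cp"
  "dp (Affine 0 0) = - cp" "dp (Affine cp 0) = 2 * cp ^ 2" "dp (Affine (- cp) 0) = - (2 * cp)"
  using cp_pos by (auto simp: descent_map_Affine)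

lemma val_torsion:
  "rat_val (int p) (- (cp ^ 2)) = 2" "rat_val (int p) (- cp) = 1" "rat_val (int p) (2 * cp ^ 2) = 2"
  "rat_val (int p) (- (2 * cp)) = 1" "rat_val 2 (- cp) = 0" "rat_val 2 (2 * cp ^ 2) = 1"
  "rat_val 2 (- (2 * cp)) = 1" "rat_val q 1 = 0"
  using cp_pos prime_ip
  by (simp_all add: rat_val_minus rat_val_mult rat_val_square rat_val_cp) (simp add: rat_val_def)

lemma on_torsion: "on (Affine 0 0)" "on (Affine cp 0)" "on (Affine (- cp) 0)"
  by (simp_all add: power2_eq_square power3_eq_cube)

lemma chi_torsion:
  assumes "on P" "P \<^bold>+ P = Infinity"
  shows "\<not> chi1 P" "\<not> chi2 P"
  using assms cp_pos unfolding two_torsion_iff[OF assms(1)] chi1_def chi2_def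
  by (auto simp: d_torsion val_torsion rat_val_cp)

text \<open>A double has positive \<open>d0\<close> of even valuation at \<open>p\<close>, whereas
  \<open>d0\<close> of each nontrivial 2-torsion point is negative or has odd valuation
  there.\<close>

lemma no_four_torsion:
  assumes "on P" "(P \<^bold>+ P) \<^bold>+ (P \<^bold>+ P) = Infinity"
  shows "P \<^bold>+ P = Infinity"
proof (rule ccontr)
  assume "P \<^bold>+ P \<noteq> Infinity"
  hence "P \<^bold>+ P \<in> {Affine 0 0, Affine cp 0, Affine (- cp) 0}"
    using two_torsion_iff[OF on_add[OF assms(1,1)]] assms(2) by blast
  hence "d0 (P \<^bold>+ P) < 0 \<or> odd (rat_val (int p) (d0 (P \<^bold>+ P)))"
    using cp_pos by (auto simp: d_torsion rat_val_cp)
  thus False using d_add_parity(1)[OF assms(1,1) prime_ip] d_add_sign[OF assms(1,1)] by simp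
qed

lemma half_of_squares:
  assumes "on (Affine x y)" "x = r ^ 2" "x - cp = s ^ 2" "x + cp = t ^ 2"
  shows "\<exists>R. on R \<and> R \<^bold>+ R = Affine x y"
proof -
  have "y ^ 2 = (r * s * t) ^ 2"
    using assms unfolding on_cases by (simp add: power_mult_distrib)
  hence "y = r * s * t \<or> y = (- r) * s * t" by (simp add: power2_eq_iff)
  moreover have "x = (- r) ^ 2" using assms(2) by simp
  ultimately obtain u where u: "x = u ^ 2" "y = u * s * t" using assms(2) by blast
  \<comment> \<open>After adjusting the sign of \<open>r\<close>, the three factors
    \<open>a\<close>, \<open>a - cp\<close>, \<open>a + cp\<close> are
    \<open>(u + s) * (u + t)\<close>, \<open>(s + u) * (s + t)\<close>,
    \<open>(t + u) * (t + s)\<close>, with product \<open>b ^ 2\<close>; the tangent at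
    \<open>(a, b)\<close> has slope \<open>u + s + t\<close>.\<close>
  define a where "a = x + u * s + s * t + t * u"
  define b where "b = (u + s) * (s + t) * (t + u)"
  have "b \<noteq> 0"
  proof
    assume "b = 0"
    hence "u ^ 2 = s ^ 2 \<or> s ^ 2 = t ^ 2 \<or> t ^ 2 = u ^ 2"
      by (auto simp: b_def add_eq_0_iff)
    thus False using assms(3,4) u(1) cp_pos by auto
  qed
  have on: "on (Affine a b)"
    unfolding on_cases a_def b_def using assms(3,4) u(1) by algebra
  have "Affine a b \<^bold>+ Affine a b = Affine x y"
  proof (rule add_eq_of_slope)
    show "ec_slope (- (cp ^ 2)) a b a b (u + s + t)"
      unfolding ec_slope_def a_def b_def using assms(3,4) u(1) by algebra
    show "x = (u + s + t) ^ 2 - a - a"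
      unfolding a_def using assms(3,4) u(1) by algebra
    show "y = (u + s + t) * (a - x) - b"
      unfolding a_def b_def u(2) by algebra
  qed (use \<open>b \<noteq> 0\<close> in \<open>simp add: eq_neg_iff_add_eq_0\<close>)
  with on show ?thesis by blast
qed

text \<open>Away from \<open>p\<close> for \<open>x\<close>, and away from 2 and \<open>p\<close>
  for \<open>x - cp\<close>, even valuation is automatic, because the shifts to the other factors
  are units there. So \<open>x\<close> and \<open>x - cp\<close> are squares, and with
  \<open>y ^ 2\<close> so is \<open>x + cp\<close>.\<close>

lemma half_of_even:
  assumes on: "on (Affine x y)" and "y \<noteq> 0" "x > 0"
    and even: "even (rat_val (int p) x)" "even (rat_val 2 (x - cp))" "even (rat_val (int p) (x - cp))"
  shows "\<exists>R. on R \<and> R \<^bold>+ R = Affine x y"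
proof -
  have eq: "y ^ 2 = x * (x - cp) * (x + cp)" using on unfolding on_cases .
  with \<open>y \<noteq> 0\<close> have nz: "x \<noteq> 0" "x - cp \<noteq> 0" by auto
  have "x * (x - cp) * (x + cp) > 0" using eq \<open>y \<noteq> 0\<close> by (metis zero_less_power2)
  with \<open>x > 0\<close> cp_pos have "x - cp > 0" by (simp add: zero_less_mult_iff)
  have "even (rat_val q x)" if "prime q" for q
  proof (cases "q = int p")
    case False
    show ?thesis
    proof (rule even_val_of_square_product)
      show "x * (x + - cp) * (x + cp) = y ^ 2" using eq by simp
    qed (use that False nz \<open>y \<noteq> 0\<close> cp_pos in \<open>auto simp: rat_val_minus rat_val_cp\<close>)
  qed (use even in simp)
  then obtain r where r: "x = r ^ 2" using rat_square_if_even_val \<open>x > 0\<close> by blast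
  have "even (rat_val q (x - cp))" if "prime q" for q
  proof (cases "q = int p \<or> q = 2")
    case False
    show ?thesis
    proof (rule even_val_of_square_product)
      show "(x - cp) * ((x - cp) + cp) * ((x - cp) + 2 * cp) = y ^ 2"
        using eq by (simp add: mult_ac)
    qed (use that False nz \<open>y \<noteq> 0\<close> cp_pos in \<open>auto simp: rat_val_mult rat_val_cp\<close>)
  qed (use even in auto)
  then obtain s where s: "x - cp = s ^ 2" using rat_square_if_even_val \<open>x - cp > 0\<close> by blast
  have "x + cp = (y / (r * s)) ^ 2"
  proof -
    have "(r * s) ^ 2 = x * (x - cp)" by (simp add: power_mult_distrib r[symmetric] s[symmetric])
    with eq nz show ?thesis by (simp add: power_divide)
  qed
  with half_of_squares[OF on r s] show ?thesis by blast
qed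

lemma half_mod_torsion:
  assumes P: "on P" "P \<^bold>+ P \<noteq> Infinity" "\<not> chi1 P" "\<not> chi2 P"
  obtains T R where "on T" "T \<^bold>+ T = Infinity" "on R" "R \<^bold>+ R = P \<^bold>+ T"
proof -
  \<comment> \<open>\<open>T\<close> is the 2-torsion point whose \<open>d0\<close> matches that of
    \<open>P\<close> in sign and in parity at \<open>p\<close>. After translation both are trivial,
    and the vanishing of \<open>chi1\<close> and \<open>chi2\<close> then gives the parities of
    \<open>dp\<close>.\<close>
  define T where "T = (if d0 P < 0
     then if odd (rat_val (int p) (d0 P)) then Affine (- cp) 0 else Affine 0 0
     else if odd (rat_val (int p) (d0 P)) then Affine cp 0 else Infinity)"
  have T: "T \<in> {Infinity, Affine 0 0, Affine cp 0, Affine (- cp) 0}"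
    by (simp add: T_def)
  hence onT: "on T" using on_torsion by auto
  with T have TT: "T \<^bold>+ T = Infinity" using two_torsion_iff by blast
  have onPT: "on (P \<^bold>+ T)" using P(1) onT by (rule on_add)
  have "d0 (P \<^bold>+ T) \<ge> 0 \<and> even (rat_val (int p) (d0 (P \<^bold>+ T))) \<and> even (rat_val 2 (dp (P \<^bold>+ T))) \<and>
      even (rat_val (int p) (dp (P \<^bold>+ T)))"
    using P(3,4) cp_pos unfolding chi1_def chi2_def not_less[symmetric]
      d_add_sign[OF P(1) onT] d_add_parity[OF P(1) onT prime_ip]
      d_add_parity[OF P(1) onT prime_two]
    by (auto simp: T_def d_torsion val_torsion rat_val_cp)
  hence par: "d0 (P \<^bold>+ T) > 0" "even (rat_val (int p) (d0 (P \<^bold>+ T)))"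
      "even (rat_val 2 (dp (P \<^bold>+ T)))" "even (rat_val (int p) (dp (P \<^bold>+ T)))"
    using d_nonzero(1)[of "P \<^bold>+ T"] by (auto simp: order.order_iff_strict)
  have "(P \<^bold>+ T) \<^bold>+ (P \<^bold>+ T) = (P \<^bold>+ P) \<^bold>+ (T \<^bold>+ T)"
    using add_assoc add_commute on_add P(1) onT by metis
  with TT P(2) have "(P \<^bold>+ T) \<^bold>+ (P \<^bold>+ T) \<noteq> Infinity" by simp
  hence nt: "P \<^bold>+ T \<notin> {Infinity, Affine 0 0, Affine cp 0, Affine (- cp) 0}"
    using two_torsion_iff[OF onPT] by blast
  then obtain x y where xy: "P \<^bold>+ T = Affine x y" by (cases "P \<^bold>+ T") auto
  have "y \<noteq> 0"
  proof
    assume "y = 0"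
    have "on (Affine x y)" using onPT xy by simp
    with \<open>y = 0\<close> have "x = 0 \<or> x = cp \<or> x = - cp"
      unfolding on_cases by (auto simp: eq_neg_iff_add_eq_0)
    with \<open>y = 0\<close> nt xy show False by auto
  qed
  moreover have "on (Affine x y)" using onPT xy by simp
  ultimately have "x \<noteq> 0" "x \<noteq> cp" unfolding on_cases by auto
  hence "d0 (P \<^bold>+ T) = x" "dp (P \<^bold>+ T) = x - cp" by (simp_all add: xy descent_map_Affine)
  with par onPT half_of_even[of x y] \<open>y \<noteq> 0\<close> obtain R where "on R" "R \<^bold>+ R = P \<^bold>+ T"
    by (auto simp: xy)
  with onT TT that show ?thesis by blast
qed

end

section \<open>Heights\<close>

definition rat_height :: "rat \<Rightarrow> nat" where
  "rat_height x = (case quotient_of x of (a, b) \<Rightarrow> nat (max \<bar>a\<bar> b))"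

lemma rat_height_cases:
  obtains a b where "x = of_int a / of_int b" "b > 0" "coprime a b" "int (rat_height x) = max \<bar>a\<bar> b"
proof -
  obtain a b where ab: "quotient_of x = (a, b)" by force
  from that[OF quotient_of_div[OF ab] quotient_of_denom_pos[OF ab] quotient_of_coprime[OF ab]]
  show ?thesis using quotient_of_denom_pos[OF ab] by (simp add: rat_height_def ab)
qed

lemma finite_rat_height_le: "finite {x. rat_height x \<le> n}"
proof (rule finite_subset)
  show "{x. rat_height x \<le> n} \<subseteq>
    (\<lambda>(a, b). of_int a / of_int b) ` ({- int n..int n} \<times> {- int n..int n})"
  proof
    fix x assume "x \<in> {x. rat_height x \<le> n}"
    moreover obtain a b where "x = of_int a / of_int b" "b > 0" "int (rat_height x) = max \<bar>a\<bar> b"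
      by (rule rat_height_cases)
    ultimately show "x \<in> (\<lambda>(a, b). of_int a / of_int b) ` ({- int n..int n} \<times> {- int n..int n})"
      by (intro image_eqI[of _ _ "(a, b)"]) auto
  qed
qed simp

text \<open>Two linear forms with coefficients \<open>a, b\<close> and \<open>c, d\<close>: the
  hypotheses bound the coefficients of their product. When the larger coefficients sit in opposite
  positions, the mixed coefficient controls their product up to one further
  \<open>M\<close>.\<close>

lemma max_mult_max_le:
  fixes a b c d M :: int
  assumes "\<bar>a * c\<bar> \<le> M" "\<bar>a * d + b * c\<bar> \<le> M" "\<bar>b * d\<bar> \<le> M"
  shows "max \<bar>a\<bar> \<bar>b\<bar> * max \<bar>c\<bar> \<bar>d\<bar> \<le> 2 * M"
proof -
  have ac: "\<bar>a\<bar> * \<bar>c\<bar> \<le> M" and bd: "\<bar>b\<bar> * \<bar>d\<bar> \<le> M"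
    using assms by (simp_all add: abs_mult)
  have "\<bar>a\<bar> * \<bar>d\<bar> \<le> \<bar>a * d + b * c\<bar> + \<bar>b\<bar> * \<bar>c\<bar>" "\<bar>b\<bar> * \<bar>c\<bar> \<le> \<bar>a * d + b * c\<bar> + \<bar>a\<bar> * \<bar>d\<bar>"
    unfolding abs_mult[symmetric] by linarith+
  hence ad: "\<bar>a\<bar> * \<bar>d\<bar> \<le> M + \<bar>b\<bar> * \<bar>c\<bar>" and bc: "\<bar>b\<bar> * \<bar>c\<bar> \<le> M + \<bar>a\<bar> * \<bar>d\<bar>"
    using assms(2) by linarith+
  have M: "M \<ge> 0" using assms(1) by linarith
  consider "\<bar>b\<bar> \<le> \<bar>a\<bar>" "\<bar>d\<bar> \<le> \<bar>c\<bar>" | "\<bar>a\<bar> \<le> \<bar>b\<bar>" "\<bar>c\<bar> \<le> \<bar>d\<bar>"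
    | "\<bar>b\<bar> \<le> \<bar>a\<bar>" "\<bar>c\<bar> \<le> \<bar>d\<bar>" | "\<bar>a\<bar> \<le> \<bar>b\<bar>" "\<bar>d\<bar> \<le> \<bar>c\<bar>" by linarith
  thus ?thesis
  proof cases
    case 1
    thus ?thesis using ac M by (simp add: max_def)
  next
    case 2
    hence "max \<bar>a\<bar> \<bar>b\<bar> = \<bar>b\<bar>" "max \<bar>c\<bar> \<bar>d\<bar> = \<bar>d\<bar>" by linarith+
    thus ?thesis using bd M by simp
  next
    case 3
    have "\<bar>b\<bar> * \<bar>c\<bar> \<le> \<bar>a\<bar> * \<bar>c\<bar>" using 3 by (intro mult_right_mono) auto
    moreover have "max \<bar>a\<bar> \<bar>b\<bar> = \<bar>a\<bar>" "max \<bar>c\<bar> \<bar>d\<bar> = \<bar>d\<bar>" using 3 by linarith+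
    ultimately show ?thesis using ad ac by simp
  next
    case 4
    have "\<bar>a\<bar> * \<bar>d\<bar> \<le> \<bar>a\<bar> * \<bar>c\<bar>" using 4 by (intro mult_left_mono) auto
    moreover have "max \<bar>a\<bar> \<bar>b\<bar> = \<bar>b\<bar>" "max \<bar>c\<bar> \<bar>d\<bar> = \<bar>c\<bar>" using 4 by linarith+
    ultimately show ?thesis using bc ac by simp
  qed
qed

text \<open>Gauss's lemma makes the coefficients of \<open>(b T - a) (d T - c)\<close> coprime.\<close>

lemma height_mult_le_of_quadratic:
  fixes X Y Z M :: int
  assumes "Z \<noteq> 0" "s + t = of_int Y / of_int Z" "s * t = of_int X / of_int Z"
    and M: "\<bar>X\<bar> \<le> M" "\<bar>Y\<bar> \<le> M" "\<bar>Z\<bar> \<le> M"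
  shows "int (rat_height s) * int (rat_height t) \<le> 2 * M"
proof -
  obtain a b where s: "s = of_int a / of_int b" "b > 0" "coprime a b"
      "int (rat_height s) = max \<bar>a\<bar> b" by (rule rat_height_cases)
  obtain c d where t: "t = of_int c / of_int d" "d > 0" "coprime c d"
      "int (rat_height t) = max \<bar>c\<bar> d" by (rule rat_height_cases)
  have "(of_int ((a * d + b * c) * Z) :: rat) = of_int (Y * (b * d))"
    using assms(1,2) s(1,2) t(1,2) by (simp add: field_simps)
  hence Y: "(a * d + b * c) * Z = Y * (b * d)" by (simp only: of_int_eq_iff)
  have "(of_int ((a * c) * Z) :: rat) = of_int (X * (b * d))"
    using assms(1,3) s(1,2) t(1,2) by (simp add: field_simps)
  hence X: "(a * c) * Z = X * (b * d)" by (simp only: of_int_eq_iff)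
  have cop: "coprime (b * d) (gcd (a * c) (a * d + b * c))"
  proof (rule ccontr)
    assume "\<not> coprime (b * d) (gcd (a * c) (a * d + b * c))"
    hence "\<not> is_unit (gcd (b * d) (gcd (a * c) (a * d + b * c)))"
      unfolding is_unit_gcd .
    moreover have "gcd (b * d) (gcd (a * c) (a * d + b * c)) \<noteq> 0" using s(2) t(2) by simp
    ultimately obtain q where "q dvd gcd (b * d) (gcd (a * c) (a * d + b * c))" "prime q"
      using prime_divisor_exists by blast
    hence q: "prime q" "q dvd b * d" "q dvd a * c" "q dvd a * d + b * c" by auto
    have no1: "\<not> (q dvd a \<and> q dvd b)" and no2: "\<not> (q dvd c \<and> q dvd d)"
      using s(3) t(3) q(1) by (meson coprime_common_divisor not_prime_unit)+
    from q(2,3) have "(q dvd b \<or> q dvd d) \<and> (q dvd a \<or> q dvd c)"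
      using q(1) by (simp add: prime_dvd_mult_iff)
    with no1 no2 have "(q dvd b \<and> q dvd c) \<or> (q dvd d \<and> q dvd a)" by blast
    thus False
    proof
      assume "q dvd b \<and> q dvd c"
      with q(4) have "q dvd a * d" by (metis dvd_add_left_iff dvd_mult2)
      with \<open>q dvd b \<and> q dvd c\<close> no1 no2 q(1) show False by (simp add: prime_dvd_mult_iff)
    next
      assume "q dvd d \<and> q dvd a"
      with q(4) have "q dvd b * c" by (metis dvd_add_right_iff dvd_mult2)
      with \<open>q dvd d \<and> q dvd a\<close> no1 no2 q(1) show False by (simp add: prime_dvd_mult_iff)
    qed
  qed
  have "b * d dvd gcd ((a * c) * Z) ((a * d + b * c) * Z)" unfolding X Y by simp
  hence "b * d dvd gcd (a * c) (a * d + b * c) * Z"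
    unfolding gcd_mult_right by (simp add: gcd.commute)
  with cop have "b * d dvd Z" by (simp add: coprime_dvd_mult_right_iff)
  then obtain k where k: "Z = b * d * k" ..
  have bd: "b * d \<noteq> 0" using s(2) t(2) by simp
  have Xk: "X = a * c * k" using X bd unfolding k by (simp add: mult_ac)
  have Yk: "Y = (a * d + b * c) * k" using Y bd unfolding k by (simp add: mult_ac)
  have "\<bar>k\<bar> \<ge> 1" using assms(1) unfolding k by auto
  hence scale: "\<bar>u\<bar> \<le> M" if "\<bar>u * k\<bar> \<le> M" for u
    using that mult_left_mono[of 1 "\<bar>k\<bar>" "\<bar>u\<bar>"] by (simp add: abs_mult)
  have "max \<bar>a\<bar> \<bar>b\<bar> * max \<bar>c\<bar> \<bar>d\<bar> \<le> 2 * M"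
    by (rule max_mult_max_le; rule scale) (use M in \<open>simp_all only: Xk Yk k\<close>)
  with s t show ?thesis by simp
qed

text \<open>
  The identities \<open>16 s^4 = (16 s^2 - 12 s t) (s + t)^2 - (5 s + 3 t) 4 s t (s - t)\<close> and its mirror
  image, with \<open>s = m^2\<close> and \<open>t = (c n)^2\<close>, bound the cancellation in the duplication formula.
\<close>

lemma duplication_cancellation:
  fixes m n c k :: int
  assumes "coprime m n" "k dvd (m ^ 2 + c ^ 2 * n ^ 2) ^ 2" "k dvd 4 * m * n * (m ^ 2 - c ^ 2 * n ^ 2)"
  shows "k dvd 16 * c ^ 8"
proof -
  define s t where "s = m ^ 2" and "t = c ^ 2 * n ^ 2"
  have N: "k dvd (s + t) ^ 2" using assms(2) by (simp add: s_def t_def)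
  have "4 * s * t * (s - t) = (4 * m * n * (m ^ 2 - c ^ 2 * n ^ 2)) * (c ^ 2 * m * n)"
    unfolding s_def t_def by algebra
  hence D: "k dvd 4 * s * t * (s - t)" using assms(3) by (metis dvd_mult2)
  have "16 * s ^ 4 = (16 * s ^ 2 - 12 * s * t) * (s + t) ^ 2 - (5 * s + 3 * t) * (4 * s * t * (s - t))"
    "16 * t ^ 4 = (16 * t ^ 2 - 12 * s * t) * (s + t) ^ 2 + (5 * t + 3 * s) * (4 * s * t * (s - t))"
    by algebra+
  with N D have "k dvd 16 * s ^ 4" "k dvd 16 * t ^ 4" by simp_all
  hence "k dvd (16 * s ^ 4) * c ^ 8" "k dvd 16 * t ^ 4" by simp_all
  moreover have "(16 * s ^ 4) * c ^ 8 = (16 * c ^ 8) * m ^ 8" "16 * t ^ 4 = (16 * c ^ 8) * n ^ 8"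
    unfolding s_def t_def by algebra+
  ultimately have "k dvd gcd ((16 * c ^ 8) * m ^ 8) ((16 * c ^ 8) * n ^ 8)" by simp
  also have "\<dots> = \<bar>(16 * c ^ 8) * gcd (m ^ 8) (n ^ 8)\<bar>"
    by (simp add: gcd_mult_left)
  also have "gcd (m ^ 8) (n ^ 8) = 1"
    using assms(1) by (simp add: coprime_iff_gcd_eq_1[symmetric])
  finally show ?thesis by simp
qed

text \<open>In integers the duplication formula reads \<open>N / D\<close>, where \<open>N\<close>
  is at least the fourth power of the height of \<open>x\<close>. Reducing the fraction loses only a
  factor \<open>k\<close> dividing \<open>16 * c ^ 8\<close>.\<close>

lemma height_duplication:
  fixes c :: int and x z :: rat
  assumes c: "c > 0" and nz: "x * (x ^ 2 - of_int c ^ 2) \<noteq> 0"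
    and z: "z = (x ^ 2 + of_int c ^ 2) ^ 2 / (4 * (x * (x ^ 2 - of_int c ^ 2)))"
  shows "int (rat_height x) ^ 4 \<le> 16 * c ^ 8 * int (rat_height z)"
proof -
  obtain m n where x: "x = of_int m / of_int n" "n > 0" "coprime m n"
      "int (rat_height x) = max \<bar>m\<bar> n" by (rule rat_height_cases)
  obtain a b where ab: "z = of_int a / of_int b" "b > 0" "coprime a b"
      "int (rat_height z) = max \<bar>a\<bar> b" by (rule rat_height_cases)
  define N where "N = (m ^ 2 + c ^ 2 * n ^ 2) ^ 2"
  define D where "D = 4 * m * n * (m ^ 2 - c ^ 2 * n ^ 2)"
  have "x ^ 2 + of_int c ^ 2 = of_int (m ^ 2 + c ^ 2 * n ^ 2) / of_int n ^ 2"
    unfolding x(1) using x(2) by (simp add: field_simps)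
  hence num: "(x ^ 2 + of_int c ^ 2) ^ 2 = of_int N / of_int n ^ 4"
    by (simp add: N_def power_divide)
  have den: "4 * (x * (x ^ 2 - of_int c ^ 2)) = of_int D / of_int n ^ 4"
    unfolding x(1) using x(2) by (simp add: D_def field_simps power2_eq_square power4_eq_xxxx)
  have "D \<noteq> 0" using nz den by auto
  have "z = of_int N / of_int D"
    unfolding z num den using x(2) by simp
  hence "(of_int (N * b) :: rat) = of_int (a * D)"
    using ab(1,2) \<open>D \<noteq> 0\<close> by (simp add: field_simps)
  hence eq: "N * b = a * D" by (simp only: of_int_eq_iff)
  hence "b dvd a * D" by (metis dvd_triv_right)
  hence "b dvd D" using ab(3) by (simp add: coprime_commute coprime_dvd_mult_right_iff)
  then obtain k where k: "D = b * k" ..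
  with eq ab(2) have Nk: "N = a * k" by simp
  have "k dvd 16 * c ^ 8"
    by (rule duplication_cancellation[OF x(3)]) (simp_all only: N_def[symmetric] D_def[symmetric] k Nk dvd_triv_right)
  hence k_le: "\<bar>k\<bar> \<le> 16 * c ^ 8" using c dvd_imp_le_int[of "16 * c ^ 8" k] by simp
  have "c ^ 2 \<ge> 1" using c by (simp add: one_le_power)
  hence "n ^ 2 \<le> c ^ 2 * n ^ 2" using mult_right_mono[of 1 "c ^ 2" "n ^ 2"] by simp
  hence "(max \<bar>m\<bar> n) ^ 2 \<le> m ^ 2 + c ^ 2 * n ^ 2"
    by (auto simp: max_def intro: add_increasing)
  hence "((max \<bar>m\<bar> n) ^ 2) ^ 2 \<le> N" unfolding N_def by (intro power_mono) auto
  hence "int (rat_height x) ^ 4 \<le> N" unfolding x(4) by (simp flip: power_mult)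
  also have "N \<le> \<bar>k\<bar> * \<bar>a\<bar>" unfolding Nk by (metis abs_ge_self abs_mult mult.commute)
  also have "\<dots> \<le> 16 * c ^ 8 * \<bar>a\<bar>" using k_le by (intro mult_right_mono) auto
  also have "\<dots> \<le> 16 * c ^ 8 * int (rat_height z)"
    unfolding ab(4) using c by (intro mult_left_mono) auto
  finally show ?thesis .
qed

section \<open>Heights of points under sum, difference and doubling\<close>

context elliptic_curve
begin

text \<open>Sum and product of the two x-coordinates are symmetric in the sign of \<open>y2\<close>,
  so the y-coordinates can be eliminated and only \<open>x1\<close>, \<open>x2\<close> remain for
  the height estimate.\<close>

lemma x_of_sum_and_difference:
  assumes "on_ec A B (Affine x1 y1)" "on_ec A B (Affine x2 y2)" "x1 \<noteq> x2"
  obtains s u t v where "Affine x1 y1 \<^bold>+ Affine x2 y2 = Affine s u"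
    "Affine x1 y1 \<^bold>+ Affine x2 (- y2) = Affine t v"
    "(s + t) * (x1 - x2) ^ 2 = 2 * ((x1 + x2) * (x1 * x2 + A) + 2 * B)"
    "(s * t) * (x1 - x2) ^ 2 = (x1 * x2 - A) ^ 2 - 4 * B * (x1 + x2)"
proof -
  obtain l s u where l: "ec_slope A x1 y1 x2 y2 l" "s = l ^ 2 - x1 - x2"
      "Affine x1 y1 \<^bold>+ Affine x2 y2 = Affine s u"
    by (rule affine_add_cases[OF assms(1,2)]) (use assms(3) in auto)
  have on2: "on_ec A B (Affine x2 (- y2))" using assms(2) by simp
  obtain k t v where k: "ec_slope A x1 y1 x2 (- y2) k" "t = k ^ 2 - x1 - x2"
      "Affine x1 y1 \<^bold>+ Affine x2 (- y2) = Affine t v"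
    by (rule affine_add_cases[OF assms(1) on2]) (use assms(3) in auto)
  have lk: "l * (x1 - x2) = y1 - y2" "k * (x1 - x2) = y1 + y2"
    using l(1) k(1) by (simp_all add: ec_slope_def)
  have y: "y1 ^ 2 = x1 ^ 3 + A * x1 + B" "y2 ^ 2 = x2 ^ 3 + A * x2 + B"
    using assms(1,2) by simp_all
  have s: "s * (x1 - x2) ^ 2 = (y1 - y2) ^ 2 - (x1 + x2) * (x1 - x2) ^ 2"
    unfolding l(2) lk[symmetric] by algebra
  have t: "t * (x1 - x2) ^ 2 = (y1 + y2) ^ 2 - (x1 + x2) * (x1 - x2) ^ 2"
    unfolding k(2) lk[symmetric] by algebra
  have sum: "(s + t) * (x1 - x2) ^ 2 = 2 * ((x1 + x2) * (x1 * x2 + A) + 2 * B)"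
    using s t y by algebra
  define w where "w = (x1 + x2) * (x1 * x2 + A) + 2 * B"
  have s': "s * (x1 - x2) ^ 2 = w - 2 * y1 * y2" and t': "t * (x1 - x2) ^ 2 = w + 2 * y1 * y2"
    unfolding w_def using s t y by algebra+
  have "((s * t) * (x1 - x2) ^ 2) * (x1 - x2) ^ 2 = w ^ 2 - 4 * (y1 ^ 2 * y2 ^ 2)"
    using s' t' by algebra
  also have "\<dots> = ((x1 * x2 - A) ^ 2 - 4 * B * (x1 + x2)) * (x1 - x2) ^ 2"
    unfolding y w_def by algebra
  finally have "(s * t) * (x1 - x2) ^ 2 = (x1 * x2 - A) ^ 2 - 4 * B * (x1 + x2)"
    using assms(3) by simp
  with l(3) k(3) sum that show ?thesis by blast
qed

lemma x_of_double:
  assumes "on_ec A B (Affine x y)" "y \<noteq> 0"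
  obtains z w where "Affine x y \<^bold>+ Affine x y = Affine z w"
    "z * (4 * (x ^ 3 + A * x + B)) = (x ^ 2 - A) ^ 2 - 8 * B * x"
proof -
  have "y + y \<noteq> 0" using assms(2) two_nonzero by (simp flip: mult_2)
  then obtain l z w where l: "ec_slope A x y x y l" "z = l ^ 2 - x - x"
      "Affine x y \<^bold>+ Affine x y = Affine z w"
    by (rule_tac affine_add_cases[OF assms(1,1)]) (auto simp: eq_neg_iff_add_eq_0)
  have "l * (2 * y) = 3 * x ^ 2 + A" using l(1) unfolding ec_slope_def by algebra
  moreover have "y ^ 2 = x ^ 3 + A * x + B" using assms(1) by simp
  ultimately have "z * (4 * (x ^ 3 + A * x + B)) = (x ^ 2 - A) ^ 2 - 8 * B * x"
    unfolding l(2) by algebra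
  with l(3) that show ?thesis by blast
qed

end

definition point_height :: "rat ec_point \<Rightarrow> nat" where
  "point_height P = (case P of Infinity \<Rightarrow> 1 | Affine x y \<Rightarrow> rat_height x)"

lemma point_height_simps [simp]:
  "point_height Infinity = 1" "point_height (Affine x y) = rat_height x"
  by (simp_all add: point_height_def)

lemma point_height_neg [simp]: "point_height (ec_neg P) = point_height P"
  by (cases P) simp_all

lemma finite_point_height_le: "finite {P. on_ec A B P \<and> point_height P \<le> n}"
proof (rule finite_subset)
  let ?X = "{x. rat_height x \<le> n}"
  let ?Y = "\<Union>x\<in>?X. {y. y ^ 2 = x ^ 3 + A * x + B}"
  show "{P. on_ec A B P \<and> point_height P \<le> n} \<subseteq> insert Infinity ((\<lambda>(x, y). Affine x y) ` (?X \<times> ?Y))"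
  proof
    fix P assume "P \<in> {P. on_ec A B P \<and> point_height P \<le> n}"
    thus "P \<in> insert Infinity ((\<lambda>(x, y). Affine x y) ` (?X \<times> ?Y))"
      by (cases P) auto
  qed
  have "finite {y::rat. y ^ 2 = w}" for w
  proof (cases "\<exists>v. v ^ 2 = w")
    case True
    then obtain v where "w = v ^ 2" by blast
    hence "{y. y ^ 2 = w} \<subseteq> {v, - v}" by (auto simp: power2_eq_iff)
    thus ?thesis by (rule finite_subset) simp
  qed simp
  thus "finite (insert Infinity ((\<lambda>(x, y). Affine x y) ` (?X \<times> ?Y)))"
    using finite_rat_height_le by simp
qed

context congruent_curve
begin

text \<open>Twice the factor \<open>4 * (1 + p ^ 2) ^ 2\<close> that bounds the quadratic forms in
  \<open>height_parallelogram\<close>; the doubling comes from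
  \<open>height_mult_le_of_quadratic\<close>.\<close>

definition hc :: nat where "hc = 8 * (1 + p ^ 2) ^ 2"

lemma cp_int: "cp = of_int (int p)"
  by (simp add: cp_def)

text \<open>The x-coordinates of \<open>P + Q\<close> and \<open>P - Q\<close> are the roots of a
  quadratic with integer coefficients \<open>Z\<close>, \<open>Y\<close>, \<open>X\<close> up to
  sign, each quadratic in the numerators and denominators of both \<open>x1\<close> and
  \<open>x2\<close>.\<close>

lemma height_parallelogram:
  assumes on: "on P" "on Q" and ne: "P \<noteq> Q" "P \<^bold>+ Q \<noteq> Infinity"
  shows "point_height (P \<^bold>+ Q) * point_height (P \<^bold>+ ec_neg Q) \<le>
    hc * (point_height P ^ 2 * point_height Q ^ 2)"
proof (cases P; cases Q)
  fix x1 y1 x2 y2 assume PQ: "P = Affine x1 y1" "Q = Affine x2 y2"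
  have "x1 \<noteq> x2" using same_x[of x1 y1 y2] on ne by (auto simp: PQ)
  then obtain s u t v where st: "P \<^bold>+ Q = Affine s u" "P \<^bold>+ ec_neg Q = Affine t v"
    "(s + t) * (x1 - x2) ^ 2 = 2 * ((x1 + x2) * (x1 * x2 + - (cp ^ 2)) + 2 * 0)"
    "(s * t) * (x1 - x2) ^ 2 = (x1 * x2 - - (cp ^ 2)) ^ 2 - 4 * 0 * (x1 + x2)"
    using x_of_sum_and_difference[OF on[unfolded PQ] \<open>x1 \<noteq> x2\<close>] unfolding PQ ec_neg.simps by blast
  obtain m a where x1: "x1 = of_int m / of_int a" "a > 0" "coprime m a"
      "int (rat_height x1) = max \<bar>m\<bar> a" by (rule rat_height_cases)
  obtain n b where x2: "x2 = of_int n / of_int b" "b > 0" "coprime n b"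
      "int (rat_height x2) = max \<bar>n\<bar> b" by (rule rat_height_cases)
  define c where "c = int p"
  define Z where "Z = (m * b - n * a) ^ 2"
  define X where "X = (m * n + c ^ 2 * (a * b)) ^ 2"
  define Y where "Y = 2 * (m * b + n * a) * (m * n - c ^ 2 * (a * b))"
  have "x1 - x2 = of_int (m * b - n * a) / of_int (a * b)"
    unfolding x1(1) x2(1) using x1(2) x2(2) by (simp add: field_simps)
  hence Z: "(x1 - x2) ^ 2 = of_int Z / of_int (a * b) ^ 2"
    by (simp add: Z_def power_divide)
  have "Z \<noteq> 0" using Z \<open>x1 \<noteq> x2\<close> by auto
  have Yeq: "2 * ((x1 + x2) * (x1 * x2 + - (cp ^ 2)) + 2 * 0) = of_int Y / of_int (a * b) ^ 2"
    unfolding x1(1) x2(1) using x1(2) x2(2) by (simp add: Y_def cp_int c_def field_simps power2_eq_square)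
  have Xeq: "(x1 * x2 - - (cp ^ 2)) ^ 2 - 4 * 0 * (x1 + x2) = of_int X / of_int (a * b) ^ 2"
    unfolding x1(1) x2(1) using x1(2) x2(2) by (simp add: X_def cp_int c_def field_simps power2_eq_square)
  have sum: "s + t = of_int Y / of_int Z"
    using st(3) \<open>Z \<noteq> 0\<close> x1(2) x2(2) unfolding Yeq Z by (simp add: field_simps)
  have prod: "s * t = of_int X / of_int Z"
    using st(4) \<open>Z \<noteq> 0\<close> x1(2) x2(2) unfolding Xeq Z by (simp add: field_simps)
  define h where "h = int (rat_height x1) * int (rat_height x2)"
  have le: "\<bar>m\<bar> * \<bar>n\<bar> \<le> h" "\<bar>m\<bar> * b \<le> h" "\<bar>n\<bar> * a \<le> h" "a * b \<le> h"
    unfolding h_def x1(4) x2(4) using x1(2) x2(2)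
    by (auto intro: mult_mono simp: mult.commute[of "\<bar>n\<bar>" a])
  have abs: "\<bar>m * n\<bar> = \<bar>m\<bar> * \<bar>n\<bar>" "\<bar>m * b\<bar> = \<bar>m\<bar> * b" "\<bar>n * a\<bar> = \<bar>n\<bar> * a" "\<bar>a * b\<bar> = a * b"
    using x1(2) x2(2) by (simp_all add: abs_mult)
  have h0: "h \<ge> 0" by (simp add: h_def)
  have c2: "c ^ 2 * (a * b) \<le> c ^ 2 * h" "0 \<le> c ^ 2 * (a * b)"
    using le(4) x1(2) x2(2) by (auto intro: mult_left_mono)
  have b1: "\<bar>m * n + c ^ 2 * (a * b)\<bar> \<le> (1 + c ^ 2) * h" "\<bar>m * n - c ^ 2 * (a * b)\<bar> \<le> (1 + c ^ 2) * h"
    using le(1) c2 abs(1) by (simp_all add: distrib_right)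
  have b2: "\<bar>m * b - n * a\<bar> \<le> 2 * h" "\<bar>m * b + n * a\<bar> \<le> 2 * h"
    using le(2,3) abs(2,3) by linarith+
  define M where "M = 4 * ((1 + c ^ 2) * h) ^ 2"
  have big: "h \<le> (1 + c ^ 2) * h" using h0 by (simp add: distrib_right)
  have MX: "\<bar>X\<bar> \<le> M"
  proof -
    have "\<bar>X\<bar> = \<bar>m * n + c ^ 2 * (a * b)\<bar> ^ 2" by (simp add: X_def)
    also have "\<dots> \<le> ((1 + c ^ 2) * h) ^ 2" using b1(1) by (intro power_mono) auto
    also have "\<dots> \<le> M" by (simp add: M_def)
    finally show ?thesis .
  qed
  have MZ: "\<bar>Z\<bar> \<le> M"
  proof -
    have "\<bar>Z\<bar> = \<bar>m * b - n * a\<bar> ^ 2" by (simp add: Z_def)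
    also have "\<dots> \<le> (2 * ((1 + c ^ 2) * h)) ^ 2" using b2(1) big by (intro power_mono) auto
    also have "\<dots> = M" by (simp add: M_def power_mult_distrib)
    finally show ?thesis .
  qed
  have MY: "\<bar>Y\<bar> \<le> M"
  proof -
    have "\<bar>Y\<bar> = 2 * (\<bar>m * b + n * a\<bar> * \<bar>m * n - c ^ 2 * (a * b)\<bar>)"
      by (simp only: Y_def abs_mult)
    also have "\<bar>m * b + n * a\<bar> * \<bar>m * n - c ^ 2 * (a * b)\<bar> \<le> (2 * ((1 + c ^ 2) * h)) * ((1 + c ^ 2) * h)"
      using b2(2) b1(2) big h0 by (intro mult_mono) auto
    also have "2 * ((2 * ((1 + c ^ 2) * h)) * ((1 + c ^ 2) * h)) = M"
      by (simp add: M_def power2_eq_square)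
    finally show ?thesis by simp
  qed
  have "int (rat_height s) * int (rat_height t) \<le> 2 * M"
    by (rule height_mult_le_of_quadratic[OF \<open>Z \<noteq> 0\<close> sum prod MX MY MZ])
  also have "2 * M = int (hc * (rat_height x1 ^ 2 * rat_height x2 ^ 2))"
    by (simp add: M_def hc_def h_def c_def power_mult_distrib)
  finally have "int (rat_height s * rat_height t) \<le> int (hc * (rat_height x1 ^ 2 * rat_height x2 ^ 2))"
    by simp
  thus ?thesis unfolding st(1,2) unfolding PQ point_height_simps by (simp only: of_nat_le_iff)
next
  have hc: "1 * k \<le> hc * k" for k by (intro mult_le_mono1) (simp add: hc_def)
  fix x y assume "P = Infinity" "Q = Affine x y"
  thus ?thesis using hc[of "rat_height x ^ 2"] by (simp add: power2_eq_square)
next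
  have hc: "1 * k \<le> hc * k" for k by (intro mult_le_mono1) (simp add: hc_def)
  fix x y assume "Q = Infinity" "P = Affine x y"
  thus ?thesis using hc[of "rat_height x ^ 2"] by (simp add: power2_eq_square)
qed (use ne in simp)

lemma height_double:
  assumes "on P" "P \<^bold>+ P \<noteq> Infinity"
  shows "point_height P ^ 4 \<le> 16 * p ^ 8 * point_height (P \<^bold>+ P)"
proof (cases P)
  case (Affine x y)
  have "y \<noteq> 0"
  proof
    assume "y = 0"
    hence "P \<^bold>+ P = Infinity" using add_neg(1)[of P] by (simp add: Affine)
    with assms(2) show False ..
  qed
  have onx: "on (Affine x y)" using assms(1) by (simp only: Affine)
  obtain z w where z: "P \<^bold>+ P = Affine z w"
      "z * (4 * (x ^ 3 + - (cp ^ 2) * x + 0)) = (x ^ 2 - - (cp ^ 2)) ^ 2 - 8 * 0 * x"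
    using x_of_double[OF onx \<open>y \<noteq> 0\<close>] unfolding Affine by blast
  have eq: "x ^ 3 + - (cp ^ 2) * x + 0 = x * (x ^ 2 - cp ^ 2)"
    by (simp add: algebra_simps power2_eq_square power3_eq_cube)
  have nz: "x * (x ^ 2 - cp ^ 2) \<noteq> 0"
    using onx \<open>y \<noteq> 0\<close> unfolding on_ec.simps eq by auto
  have "int (rat_height x) ^ 4 \<le> 16 * int p ^ 8 * int (rat_height z)"
  proof (rule height_duplication)
    show "int p > 0" using p(1) by (simp add: prime_gt_0_nat)
    show "x * (x ^ 2 - of_int (int p) ^ 2) \<noteq> 0" using nz by (simp add: cp_int)
    show "z = (x ^ 2 + of_int (int p) ^ 2) ^ 2 / (4 * (x * (x ^ 2 - of_int (int p) ^ 2)))"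
      using z(2) nz unfolding eq cp_int[symmetric] by (subst nonzero_eq_divide_eq) simp_all
  qed
  hence "int (rat_height x ^ 4) \<le> int (16 * p ^ 8 * rat_height z)" by simp
  thus ?thesis unfolding z(1) unfolding Affine point_height_simps by (simp only: of_nat_le_iff)
qed (use assms in simp)

lemma height_torsion:
  assumes "on T" "T \<^bold>+ T = Infinity"
  shows "point_height T \<le> p"
proof -
  have "p \<ge> 1" using p(1) by (simp add: prime_gt_0_nat Suc_leI)
  moreover have "quotient_of cp = (int p, 1)" "quotient_of (- cp) = (- int p, 1)"
    unfolding cp_int by (simp_all only: quotient_of_rat_of_int of_int_minus[symmetric])
  ultimately show ?thesis
    using assms two_torsion_iff[OF assms(1)] by (auto simp: rat_height_def)
qed

text \<open>Since \<open>T = - T\<close>, the parallelogram inequality for \<open>P\<close> and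
  \<open>T\<close> bounds the square of the height of \<open>P + T\<close>; the doubling estimate
  for \<open>R\<close> then gives the fourth power.\<close>

lemma halving_descent:
  assumes P: "on P" "P \<^bold>+ P \<noteq> Infinity" "\<not> chi1 P" "\<not> chi2 P"
  shows "\<exists>R. on R \<and> (R \<^bold>+ R) \<^bold>+ (R \<^bold>+ R) = P \<^bold>+ P \<and>
    point_height R ^ 4 \<le> 16 * p ^ 9 * hc * point_height P"
proof -
  obtain T R where T: "on T" "T \<^bold>+ T = Infinity" and R: "on R" "R \<^bold>+ R = P \<^bold>+ T"
    by (rule half_mod_torsion[OF P])
  have dbl: "(R \<^bold>+ R) \<^bold>+ (R \<^bold>+ R) = P \<^bold>+ P"
  proof -
    have "(P \<^bold>+ T) \<^bold>+ (P \<^bold>+ T) = (P \<^bold>+ P) \<^bold>+ (T \<^bold>+ T)"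
      using add_assoc add_commute on_add P(1) T(1) by metis
    thus ?thesis using R(2) T(2) by simp
  qed
  have "P \<noteq> T" using P(2) T(2) by blast
  have neg: "ec_neg T = T"
    using add_cancel[OF T(1,1)] T(2) by simp
  have ne: "P \<^bold>+ T \<noteq> Infinity"
  proof
    assume "P \<^bold>+ T = Infinity"
    hence "P = T" using add_cancel[OF P(1) T(1)] neg by simp
    with \<open>P \<noteq> T\<close> show False ..
  qed
  have p1: "p \<ge> 1" using p(1) by (simp add: prime_gt_0_nat Suc_leI)
  have "point_height (P \<^bold>+ T) ^ 2 \<le> hc * (point_height P ^ 2 * point_height T ^ 2)"
    using height_parallelogram[OF P(1) T(1) \<open>P \<noteq> T\<close> ne] by (simp add: neg power2_eq_square)
  also have "\<dots> \<le> hc * (point_height P ^ 2 * p ^ 2)"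
    using height_torsion[OF T] by (intro mult_le_mono2 power_mono) auto
  \<comment> \<open>Enlarging \<open>hc\<close> to its square makes the bound a perfect square, so
    the root can be taken in the natural numbers.\<close>
  also have "\<dots> \<le> hc ^ 2 * (point_height P ^ 2 * p ^ 2)"
    by (intro mult_le_mono1) (simp add: power2_eq_square)
  also have "\<dots> = (hc * p * point_height P) ^ 2" by (simp add: power_mult_distrib)
  finally have le: "point_height (P \<^bold>+ T) \<le> hc * p * point_height P"
    by (simp add: power2_nat_le_eq_le)
  have "point_height R ^ 4 \<le> 16 * p ^ 8 * point_height (P \<^bold>+ T)"
    using height_double[OF R(1)] ne by (simp add: R(2))
  also have "\<dots> \<le> 16 * p ^ 8 * (hc * p * point_height P)"
    using le by (intro mult_le_mono2)
  also have "\<dots> = 16 * p ^ 9 * hc * point_height P" by (simp add: power_numeral_reduce)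
  finally show ?thesis using dbl R(1) by blast
qed

section \<open>Upper and lower bounds for the rank\<close>

lemma rank_le_2: "abelian_group_rank E \<le> 2"
proof -
  interpret E: comm_group E by (rule comm_group_ec)
  have car: "P \<in> carrier E \<longleftrightarrow> on P" and mult: "P \<otimes>\<^bsub>E\<^esub> Q = P \<^bold>+ Q" and one: "\<one>\<^bsub>E\<^esub> = Infinity" for P Q
    by (simp_all add: ec_group_def)
  have inv: "inv\<^bsub>E\<^esub> P = ec_neg P" if "on P" for P
    by (rule E.inv_equality) (use that in \<open>simp_all add: car mult one add_neg\<close>)
  have C: "hc \<le> 16 * p ^ 9 * hc"
    using p(1) by (simp add: prime_gt_0_nat Suc_leI)
  interpret height_descent E chi1 chi2 point_height "16 * p ^ 9 * hc"
  proof
    fix P Q assume "P \<in> carrier E" "Q \<in> carrier E"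
    thus "chi1 (P \<otimes>\<^bsub>E\<^esub> Q) = (chi1 P \<noteq> chi1 Q)" "chi2 (P \<otimes>\<^bsub>E\<^esub> Q) = (chi2 P \<noteq> chi2 Q)"
      by (simp_all add: car mult chi_add)
  next
    fix b show "finite {P \<in> carrier E. point_height P \<le> b}"
      by (simp add: car finite_point_height_le)
  next
    fix P Q assume PQ: "P \<in> carrier E" "Q \<in> carrier E" "P \<noteq> Q" "P \<otimes>\<^bsub>E\<^esub> Q \<noteq> \<one>\<^bsub>E\<^esub>"
    hence "point_height (P \<^bold>+ Q) * point_height (P \<^bold>+ ec_neg Q) \<le>
        hc * (point_height P ^ 2 * point_height Q ^ 2)"
      by (intro height_parallelogram) (simp_all add: car mult one)
    also have "\<dots> \<le> 16 * p ^ 9 * hc * (point_height P ^ 2 * point_height Q ^ 2)"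
      by (rule mult_le_mono1[OF C])
    finally show "point_height (P \<otimes>\<^bsub>E\<^esub> Q) * point_height (P \<otimes>\<^bsub>E\<^esub> inv\<^bsub>E\<^esub> Q) \<le>
        16 * p ^ 9 * hc * (point_height P ^ 2 * point_height Q ^ 2)"
      using PQ by (simp add: car mult inv)
  next
    fix P assume "P \<in> carrier E" "\<not> chi1 P" "\<not> chi2 P" "P \<otimes>\<^bsub>E\<^esub> P \<noteq> \<one>\<^bsub>E\<^esub>"
    thus "\<exists>R\<in>carrier E. R \<otimes>\<^bsub>E\<^esub> R \<otimes>\<^bsub>E\<^esub> (R \<otimes>\<^bsub>E\<^esub> R) = P \<otimes>\<^bsub>E\<^esub> P \<and>
        point_height R ^ 4 \<le> 16 * p ^ 9 * hc * point_height P"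
      using halving_descent[of P] by (auto simp: car mult one)
  qed
  show ?thesis by (rule rank_le_2)
qed

lemma rank_ge_2:
  assumes "on P" "chi1 P" "\<not> chi2 P" "on Q" "\<not> chi1 Q" "chi2 Q"
  shows "abelian_group_rank E \<ge> 2"
proof -
  interpret E: comm_group E by (rule comm_group_ec)
  have car: "P \<in> carrier E \<longleftrightarrow> on P" and mult: "P \<otimes>\<^bsub>E\<^esub> Q = P \<^bold>+ Q" and one: "\<one>\<^bsub>E\<^esub> = Infinity" for P Q
    by (simp_all add: ec_group_def)
  have hom: "chi1 (P \<otimes>\<^bsub>E\<^esub> Q) \<longleftrightarrow> chi1 P \<noteq> chi1 Q" "chi2 (P \<otimes>\<^bsub>E\<^esub> Q) \<longleftrightarrow> chi2 P \<noteq> chi2 Q"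
    if "P \<in> carrier E" "Q \<in> carrier E" for P Q
    using that chi_add unfolding car mult by blast+
  have tors: "\<not> chi1 P \<and> \<not> chi2 P" if "P \<in> carrier E" "P \<otimes>\<^bsub>E\<^esub> P = \<one>\<^bsub>E\<^esub>" for P
    using that chi_torsion unfolding car mult one by blast
  have four: "P \<otimes>\<^bsub>E\<^esub> P = \<one>\<^bsub>E\<^esub>"
    if "P \<in> carrier E" "(P \<otimes>\<^bsub>E\<^esub> P) \<otimes>\<^bsub>E\<^esub> (P \<otimes>\<^bsub>E\<^esub> P) = \<one>\<^bsub>E\<^esub>" for P
    using that no_four_torsion unfolding car mult one by blast
  have PQ: "P \<in> carrier E" "Q \<in> carrier E" using assms by (simp_all add: car)
  note pair = E.int_independent_pair[of chi1 chi2, OF hom tors four PQ(1) assms(2,3) PQ(2) assms(5,6)]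
  have "int_independent E {P, Q}" "P \<noteq> Q" using pair by blast+
  hence "enat (card {P, Q}) \<le> abelian_group_rank E"
    unfolding abelian_group_rank_def by (intro SUP_upper) simp
  thus ?thesis using \<open>P \<noteq> Q\<close> by (simp add: numeral_eq_enat numeral_2_eq_2)
qed

end

section \<open>Two independent points\<close>

context congruent_curve
begin

text \<open>For square \<open>x\<close> the contribution of \<open>d0\<close> is trivial, and the
  characters read the class \<open>k\<close> of \<open>x - cp\<close> at 2 and at \<open>p\<close>.
  The values \<open>k = 2\<close> and \<open>k = cp\<close> provide the two points.\<close>

lemma chi_of_square_classes:
  assumes "x = u ^ 2" "x - cp = k * v ^ 2" "u \<noteq> 0" "v \<noteq> 0" "k \<noteq> 0"
  shows "chi1 (Affine x y) \<longleftrightarrow> odd (rat_val 2 k)" "chi2 (Affine x y) \<longleftrightarrow> odd (rat_val (int p) k)"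
proof -
  have "x \<noteq> 0" "x \<noteq> cp" using assms by auto
  hence "d0 (Affine x y) = u ^ 2" "dp (Affine x y) = k * v ^ 2"
    using assms(1,2) by (simp_all add: descent_map_Affine)
  thus "chi1 (Affine x y) \<longleftrightarrow> odd (rat_val 2 k)" "chi2 (Affine x y) \<longleftrightarrow> odd (rat_val (int p) k)"
    using assms(3-5) prime_ip by (simp_all add: chi1_def chi2_def rat_val_mult rat_val_square)
qed

text \<open>
  Both points below are images under the dual isogeny of points on \<open>y^2 = x^3 + 4 p^2 x\<close>, with
  \<open>x\<close>-coordinates \<open>2 c^2\<close> and \<open>p m^2 / b^2\<close> respectively.
\<close>

lemma point_of_sum_condition:
  fixes a b c d :: int
  assumes "a > 0" "b > 0" "int p = a + b" "a - b = c ^ 2" "a ^ 2 + b ^ 2 = d ^ 2"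
  shows "\<exists>P. on P \<and> chi1 P \<and> \<not> chi2 P"
proof -
  have "c \<noteq> 0"
  proof
    assume "c = 0"
    hence "int p = 2 * b" using assms(3,4) by simp
    with p(2) show False by presburger
  qed
  have "d \<noteq> 0" using assms(1,2,5) by (auto simp: sum_power2_eq_zero_iff)
  define u v w :: rat where "u = of_int d / of_int c" and "v = of_int b / of_int c" and "w = of_int a / of_int c"
  have eqs: "(of_int d :: rat) ^ 2 = of_int a ^ 2 + of_int b ^ 2" "(of_int c :: rat) ^ 2 = of_int a - of_int b"
    "cp = of_int a + of_int b"
    using assms(3-5) unfolding cp_int by (metis of_int_power of_int_add of_int_diff)+
  \<comment> \<open>Because \<open>cp * c ^ 2 = a ^ 2 - b ^ 2\<close>, subtracting it from or adding
    it to \<open>a ^ 2 + b ^ 2\<close> leaves twice a square.\<close>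
  have "(of_int d :: rat) ^ 2 - cp * of_int c ^ 2 = 2 * of_int b ^ 2"
    "(of_int d :: rat) ^ 2 + cp * of_int c ^ 2 = 2 * of_int a ^ 2"
    using eqs by algebra+
  hence minus: "u ^ 2 - cp = 2 * v ^ 2" and plus: "u ^ 2 + cp = 2 * w ^ 2"
    unfolding u_def v_def w_def power_divide using \<open>c \<noteq> 0\<close> by (simp_all add: divide_simps)
  have "on (Affine (u ^ 2) (2 * u * v * w))"
    unfolding on_cases minus plus by (simp add: power_mult_distrib)
  moreover have "u \<noteq> 0" "v \<noteq> 0"
    using \<open>c \<noteq> 0\<close> \<open>d \<noteq> 0\<close> assms(2) by (simp_all add: u_def v_def)
  hence "chi1 (Affine (u ^ 2) (2 * u * v * w))" "\<not> chi2 (Affine (u ^ 2) (2 * u * v * w))"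
    using chi_of_square_classes[OF refl minus] rat_val_cp by simp_all
  ultimately show ?thesis by blast
qed

lemma point_of_norm_condition:
  fixes a b s :: int
  assumes "b \<noteq> 0" "int p = a ^ 2 + b ^ 2" "(a + 2 * b) ^ 2 + b ^ 2 = s ^ 2"
  shows "\<exists>P. on P \<and> \<not> chi1 P \<and> chi2 P"
proof -
  define m where "m = a + b"
  have "odd (int p)" using p(2) by simp
  hence "odd (a ^ 2 + b ^ 2)" unfolding assms(2) .
  hence "odd m" by (simp add: m_def)
  \<comment> \<open>Oddness of \<open>m\<close> keeps the denominator \<open>n\<close> and the value
    \<open>v\<close> nonzero, so that \<open>x\<close> differs from \<open>cp\<close>.\<close>
  hence "m \<noteq> 0" "m ^ 2 \<noteq> 2 * b ^ 2" by (auto dest: arg_cong[of _ _ even])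
  have "s \<noteq> 0" using assms(1,3) by (auto simp: sum_power2_eq_zero_iff)
  \<comment> \<open>Sophie Germain factorization: the factors are
    \<open>(m + b) ^ 2 + b ^ 2 = s ^ 2\<close> and \<open>(m - b) ^ 2 + b ^ 2 = p\<close>.\<close>
  have "m ^ 4 + 4 * b ^ 4 = int p * s ^ 2"
    unfolding m_def assms(2) assms(3)[symmetric] by algebra
  hence "(of_int (m ^ 4 + 4 * b ^ 4) :: rat) = of_int (int p * s ^ 2)" by (simp only:)
  hence eq: "(of_int m :: rat) ^ 4 + 4 * of_int b ^ 4 = cp * of_int s ^ 2"
    unfolding cp_int by simp
  define n :: rat where "n = 2 * of_int m * of_int b"
  have "n \<noteq> 0" using \<open>m \<noteq> 0\<close> assms(1) by (simp add: n_def)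
  define u v w :: rat where "u = cp * of_int s / n" and "v = of_int (m ^ 2 - 2 * b ^ 2) / n"
    and "w = of_int (m ^ 2 + 2 * b ^ 2) / n"
  have n2: "n ^ 2 = 4 * of_int m ^ 2 * of_int b ^ 2" by (simp add: n_def power_mult_distrib)
  \<comment> \<open>Subtracting or adding \<open>n ^ 2 = 4 * m ^ 2 * b ^ 2\<close> completes
    \<open>m ^ 4 + 4 * b ^ 4\<close> to a square.\<close>
  have "(cp * of_int s) ^ 2 - cp * n ^ 2 = cp * of_int (m ^ 2 - 2 * b ^ 2) ^ 2"
    "(cp * of_int s) ^ 2 + cp * n ^ 2 = cp * of_int (m ^ 2 + 2 * b ^ 2) ^ 2"
    unfolding n2 using eq by (simp; algebra)+
  hence minus: "u ^ 2 - cp = cp * v ^ 2" and plus: "u ^ 2 + cp = cp * w ^ 2"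
    unfolding u_def v_def w_def power_divide using \<open>n \<noteq> 0\<close> by (simp_all add: divide_simps)
  have "on (Affine (u ^ 2) (cp * u * v * w))"
    unfolding on_cases minus plus by (simp add: power_mult_distrib power2_eq_square)
  moreover have "of_int (m ^ 2 - 2 * b ^ 2) \<noteq> (0 :: rat)"
    using \<open>m ^ 2 \<noteq> 2 * b ^ 2\<close> by (simp only: of_int_eq_0_iff)
  hence "u \<noteq> 0" "v \<noteq> 0"
    using \<open>n \<noteq> 0\<close> \<open>s \<noteq> 0\<close> cp_pos by (simp_all only: u_def v_def) simp_all
  hence "\<not> chi1 (Affine (u ^ 2) (cp * u * v * w))" "chi2 (Affine (u ^ 2) (cp * u * v * w))"
    using chi_of_square_classes[OF refl minus] rat_val_cp cp_pos by simp_all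
  ultimately show ?thesis by blast
qed

end

section \<open>Rank two for primes satisfying both conditions\<close>

theorem corollary3p43:
  fixes p :: nat
  assumes "prime p"
    and "p mod 8 = 1"
    and "\<exists>a b :: nat. a > 0 \<and> b > 0 \<and> p = a + b \<and>
           is_square (int a - int b) \<and> is_square (a ^ 2 + b ^ 2)"
    and "\<exists>a b :: nat. a > 0 \<and> b > 0 \<and> p = a ^ 2 + b ^ 2 \<and> gcd a (2 * b) = 1 \<and>
           (is_square ((int a + 2 * int b) ^ 2 + int b ^ 2) \<or>
            is_square ((int a - 2 * int b) ^ 2 + int b ^ 2))"
  shows "abelian_group_rank (ec_group (- (of_nat p ^ 2) :: rat) 0) = 2"
proof -
  have "odd p" using assms(2) by presburger
  then interpret congruent_curve p by unfold_locales (rule assms(1))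
  obtain P where P: "on P" "chi1 P" "\<not> chi2 P"
  proof -
    obtain a b :: nat and c :: int and d :: nat
      where ab: "a > 0" "b > 0" "p = a + b" "int a - int b = c ^ 2" "a ^ 2 + b ^ 2 = d ^ 2"
      using assms(3) by (auto elim!: is_nth_powerE)
    have "(int a) ^ 2 + (int b) ^ 2 = (int d) ^ 2"
      using ab(5) by (metis of_nat_add of_nat_power)
    with ab that point_of_sum_condition[of "int a" "int b" c "int d"] show ?thesis by auto
  qed
  moreover obtain Q where "on Q" "\<not> chi1 Q" "chi2 Q"
  proof -
    obtain a b :: nat where ab: "b > 0" "p = a ^ 2 + b ^ 2"
        "is_square ((int a + 2 * int b) ^ 2 + int b ^ 2) \<or>
         is_square ((int a - 2 * int b) ^ 2 + int b ^ 2)"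
      using assms(4) by blast
    \<comment> \<open>The two alternatives differ by the sign of \<open>b\<close>, which
      \<open>e\<close> carries; \<open>a ^ 2 + e ^ 2\<close> is still \<open>p\<close>.\<close>
    then obtain s e :: int where "(int a + 2 * e) ^ 2 + e ^ 2 = s ^ 2" "e = int b \<or> e = - int b"
      by (elim disjE is_nth_powerE) (metis, metis diff_conv_add_uminus mult_minus_right power2_minus)
    with ab that point_of_norm_condition[of e "int a" s] show ?thesis by auto
  qed
  ultimately have "abelian_group_rank E \<ge> 2" by (rule rank_ge_2)
  with rank_le_2 have "abelian_group_rank E = 2" by (rule antisym)
  thus ?thesis by (simp only: cp_def)
qed

end
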